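(* Enum Minimal MC admits a fully-polynomial enumeration kernel with at most $6k$ vertices when parameterized by the modular width $k$ of the input graph.
   Context: The modular width ${\sf mw}(G)$ is the minimum positive integer $k$ such that a graph isomorphic to $G$ can be built recursively by: creating a single-vertex graph; or the substitution operation, which for a graph $Q$ on vertices $v_1,\dots,v_r$ with $2\le r\le k$ and disjoint graphs $G_1,\dots,G_r$ of modular width at most $k$ produces the graph with vertex set $\bigcup_i V(G_i)$ and edge set $\bigcup_i E(G_i)\cup\bigcup_{v_iv_j\in E(Q)}\{xy: x\in V(G_i), y\in V(G_j)\}$. A matching cut of $G$ is a (possibly empty) edge set $M$ that is a matching and equals $E(A,B)$ (edges between $A$ and $B$) for some partition $\{A,B\}$ of $V(G)$; it is minimal if no matching cut is a proper subset of it. Enum Minimal MC: given $G$, list all minimal matching cuts without repetition. For a parameterized enumeration problem (instances $x$, solutions $\mathsf{Sol}(x)$, parameter $\kappa(x)$), a fully-polynomial enumeration kernel is a pair of algorithms $\mathcal A,\mathcal A'$ where $\mathcal A$ computes in time polynomial in $|x|+\kappa(x)$ an instance $y$ with $|y|+\kappa(y)\le f(\kappa(x))$ ($f$ computable), and for each $s\in\mathsf{Sol}(y)$, $\mathcal A'$ computes in time polynomial in $|x|+|y|+\kappa(x)+\kappa(y)$ a nonempty $S_s\subseteq\mathsf{Sol}(x)$ such that $\{S_s\}_{s\in\mathsf{Sol}(y)}$ partitions $\mathsf{Sol}(x)$. *)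

theory Defs
  imports "HOL-Computational_Algebra.Polynomial" "HOL-Library.Disjoint_Sets"
begin

section \<open>Graphs, modular width and matching cuts\<close>

type_synonym 'v graph = "'v set \<times> 'v set set"

abbreviation verts :: "'v graph \<Rightarrow> 'v set" where "verts G \<equiv> fst G"
abbreviation edges :: "'v graph \<Rightarrow> 'v set set" where "edges G \<equiv> snd G"

definition simple_graph :: "'v graph \<Rightarrow> bool" where
  "simple_graph G \<longleftrightarrow> finite (verts G) \<and> verts G \<noteq> {} \<and>
     (\<forall>e\<in>edges G. e \<subseteq> verts G \<and> card e = 2)"

definition isomorphic :: "'v graph \<Rightarrow> 'w graph \<Rightarrow> bool" where
  "isomorphic G H \<longleftrightarrow>
     (\<exists>\<phi>. bij_betw \<phi> (verts G) (verts H) \<and> edges H = (\<lambda>e. \<phi> ` e) ` edges G)"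

definition substitution :: "'q graph \<Rightarrow> ('q \<Rightarrow> 'v graph) \<Rightarrow> 'v graph" where
  "substitution Q G =
     ((\<Union>i\<in>verts Q. verts (G i)),
      (\<Union>i\<in>verts Q. edges (G i)) \<union>
      {{x, y} |x y i j. {i, j} \<in> edges Q \<and> x \<in> verts (G i) \<and> y \<in> verts (G j)})"

text \<open>The graph into which the parts are substituted has vertices in \<^typ>\<open>nat\<close>; since it is finite
  and its vertices only index the parts, this is no restriction.\<close>

inductive mw_constructible :: "nat \<Rightarrow> 'v graph \<Rightarrow> bool" for k :: nat where
  single: "mw_constructible k ({v}, {})"
| subst: "\<lbrakk>simple_graph (Q :: nat graph); 2 \<le> card (verts Q); card (verts Q) \<le> k;
           \<And>i. i \<in> verts Q \<Longrightarrow> mw_constructible k (G i);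
           disjoint_family_on (\<lambda>i. verts (G i)) (verts Q)\<rbrakk>
          \<Longrightarrow> mw_constructible k (substitution Q G)"

definition modular_width :: "'v graph \<Rightarrow> nat" where
  "modular_width G =
     (LEAST k. 0 < k \<and> (\<exists>H :: 'v graph. isomorphic H G \<and> mw_constructible k H))"

definition matching :: "'v set set \<Rightarrow> bool" where
  "matching M \<longleftrightarrow> (\<forall>e\<in>M. \<forall>e'\<in>M. e \<noteq> e' \<longrightarrow> e \<inter> e' = {})"

definition edges_between :: "'v graph \<Rightarrow> 'v set \<Rightarrow> 'v set \<Rightarrow> 'v set set" where
  "edges_between G A B = {e \<in> edges G. \<exists>x\<in>A. \<exists>y\<in>B. e = {x, y}}"

definition matching_cut :: "'v graph \<Rightarrow> 'v set set \<Rightarrow> bool" where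
  "matching_cut G M \<longleftrightarrow> matching M \<and>
     (\<exists>A B. partition_on (verts G) {A, B} \<and> A \<noteq> B \<and> M = edges_between G A B)"

definition minimal_matching_cut :: "'v graph \<Rightarrow> 'v set set \<Rightarrow> bool" where
  "minimal_matching_cut G M \<longleftrightarrow> matching_cut G M \<and> \<not> (\<exists>M'. matching_cut G M' \<and> M' \<subset> M)"


section \<open>Programs with a cost semantics\<close>

text \<open>A while language whose values are binary trees. An assignment is charged
  the size of the value it stores. The total size of the store therefore never exceeds the size of
  the input plus the time used so far, so every step of a fixed program can be carried out
  by a Turing machine in time polynomial in input size plus elapsed time; conversely, a Turing
  machine configuration is a constant number of lists (the halves of the tapes), updated by
  a constant number of assignments per step. Up to polynomial overhead
  the time below is hence Turing machine time.\<close>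

datatype tree = Leaf | Node tree tree

datatype expr =
    Var nat
  | Const tree
  | Cons expr expr
  | Hd expr
  | Tl expr
  | Equal expr expr

datatype com =
    Skip
  | Assign nat expr
  | Seq com com
  | If expr com com
  | While expr com

type_synonym store = "nat \<Rightarrow> tree"

fun left :: "tree \<Rightarrow> tree" where
  "left Leaf = Leaf"
| "left (Node a b) = a"

fun right :: "tree \<Rightarrow> tree" where
  "right Leaf = Leaf"
| "right (Node a b) = b"

definition tree_of_bool :: "bool \<Rightarrow> tree" where
  "tree_of_bool b = (if b then Node Leaf Leaf else Leaf)"

primrec tree_of_list :: "tree list \<Rightarrow> tree" where
  "tree_of_list [] = Leaf"
| "tree_of_list (x # xs) = Node x (tree_of_list xs)"

definition tree_of_nat :: "nat \<Rightarrow> tree" where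
  "tree_of_nat n = tree_of_list (replicate n Leaf)"

primrec val :: "expr \<Rightarrow> store \<Rightarrow> tree" where
  "val (Var x) s = s x"
| "val (Const a) s = a"
| "val (Cons e e') s = Node (val e s) (val e' s)"
| "val (Hd e) s = left (val e s)"
| "val (Tl e) s = right (val e s)"
| "val (Equal e e') s = tree_of_bool (val e s = val e' s)"

text \<open>\<open>exec c s t s'\<close>: started in store \<open>s\<close>, the program \<open>c\<close> halts in store \<open>s'\<close> after time \<open>t\<close>.
  Every tree other than \<^const>\<open>Leaf\<close> counts as true.\<close>

inductive exec :: "com \<Rightarrow> store \<Rightarrow> nat \<Rightarrow> store \<Rightarrow> bool" where
  Skip: "exec Skip s 1 s"
| Assign: "exec (Assign x e) s (1 + size (val e s)) (s(x := val e s))"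
| Seq: "\<lbrakk>exec c s t s'; exec c' s' t' s''\<rbrakk> \<Longrightarrow> exec (Seq c c') s (t + t') s''"
| IfTrue: "\<lbrakk>val e s \<noteq> Leaf; exec c s t s'\<rbrakk> \<Longrightarrow> exec (If e c c') s (1 + t) s'"
| IfFalse: "\<lbrakk>val e s = Leaf; exec c' s t s'\<rbrakk> \<Longrightarrow> exec (If e c c') s (1 + t) s'"
| WhileFalse: "val e s = Leaf \<Longrightarrow> exec (While e c) s 1 s"
| WhileTrue: "\<lbrakk>val e s \<noteq> Leaf; exec c s t s'; exec (While e c) s' t' s''\<rbrakk>
              \<Longrightarrow> exec (While e c) s (1 + t + t') s''"

inductive_cases SkipE: "exec Skip s t s'"
inductive_cases AssignE: "exec (Assign x e) s t s'"
inductive_cases SeqE: "exec (Seq c c') s t s'"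
inductive_cases IfE: "exec (If e c c') s t s'"
inductive_cases WhileE: "exec (While e c) s t s'"

lemma exec_deterministic: "\<lbrakk>exec c s t s'; exec c s u s''\<rbrakk> \<Longrightarrow> t = u \<and> s' = s''"
proof (induction c s t s' arbitrary: u s'' rule: exec.induct)
  case Skip
  then show ?case by (elim SkipE) simp
next
  case Assign
  then show ?case by (elim AssignE) simp
next
  case Seq
  from Seq.prems show ?case by (elim SeqE) (metis Seq.IH)
next
  case IfTrue
  from IfTrue.prems show ?case by (elim IfE) (use IfTrue.hyps(1) in \<open>auto dest: IfTrue.IH\<close>)
next
  case IfFalse
  from IfFalse.prems show ?case by (elim IfE) (use IfFalse.hyps(1) in \<open>auto dest: IfFalse.IH\<close>)
next
  case WhileFalse
  from WhileFalse.prems show ?case by (rule WhileE) (use WhileFalse.hyps in auto)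
next
  case (WhileTrue e s c t s1 t' s2)
  from WhileTrue.prems \<open>val e s \<noteq> Leaf\<close> obtain v s3 v'
    where u: "u = 1 + v + v'" and body: "exec c s v s3" and rest: "exec (While e c) s3 v' s''"
    by - (erule WhileE, auto)
  from WhileTrue.IH(1)[OF body] have "t = v" "s1 = s3" by auto
  with WhileTrue.IH(2) rest u show ?case by simp
qed

text \<open>Input and output are passed in variable 0; the other variables are initially empty.\<close>

definition outputs_in_time :: "com \<Rightarrow> tree \<Rightarrow> tree \<Rightarrow> nat \<Rightarrow> bool" where
  "outputs_in_time c a b t \<longleftrightarrow> (\<exists>s. exec c ((\<lambda>_. Leaf)(0 := a)) t s \<and> s 0 = b)"

definition computable :: "(nat \<Rightarrow> nat) \<Rightarrow> bool" where
  "computable f \<longleftrightarrow>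
     (\<exists>c. \<forall>n. \<exists>t. outputs_in_time c (tree_of_nat n) (tree_of_nat (f n)) t)"


section \<open>Parameterized enumeration problems and kernels\<close>

record ('i, 's) enumeration_problem =
  Inst :: "'i set"
  Sol :: "'i \<Rightarrow> 's set"
  param :: "'i \<Rightarrow> nat"
  inst_enc :: "'i \<Rightarrow> tree"
  sol_enc :: "'i \<Rightarrow> 's \<Rightarrow> tree"

definition inst_size :: "('i, 's) enumeration_problem \<Rightarrow> 'i \<Rightarrow> nat" where
  "inst_size P x = size (inst_enc P x)"

text \<open>Here \<open>kern\<close> and \<open>lift\<close> are the functions computed by the two algorithms \<open>\<A>\<close> and \<open>\<A>'\<close>:
  \<open>kern x\<close> is the compressed instance, and \<open>lift x s\<close> lists, without repetition, the set
  of solutions of \<open>x\<close> assigned to the solution \<open>s\<close> of \<open>kern x\<close>. These sets have to be disjoint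
  as an indexed family.\<close>

definition fully_polynomial_enumeration_kernel ::
  "('i, 's) enumeration_problem \<Rightarrow> ('i \<Rightarrow> 'i) \<Rightarrow> ('i \<Rightarrow> 's \<Rightarrow> 's list) \<Rightarrow> bool" where
  "fully_polynomial_enumeration_kernel P kern lift \<longleftrightarrow>
     (\<forall>x\<in>Inst P. kern x \<in> Inst P) \<and>
     (\<exists>\<A> (p :: nat poly). \<forall>x\<in>Inst P. \<exists>t \<le> poly p (inst_size P x + param P x).
        outputs_in_time \<A> (inst_enc P x) (inst_enc P (kern x)) t) \<and>
     (\<exists>f. computable f \<and>
        (\<forall>x\<in>Inst P. inst_size P (kern x) + param P (kern x) \<le> f (param P x))) \<and>
     (\<exists>\<A>' (q :: nat poly). \<forall>x\<in>Inst P. \<forall>s\<in>Sol P (kern x).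
        \<exists>t \<le> poly q (inst_size P x + inst_size P (kern x) + param P x + param P (kern x)).
          outputs_in_time \<A>'
            (Node (inst_enc P x) (Node (inst_enc P (kern x)) (sol_enc P (kern x) s)))
            (tree_of_list (map (sol_enc P x) (lift x s))) t) \<and>
     (\<forall>x\<in>Inst P.
        (\<forall>s\<in>Sol P (kern x). distinct (lift x s) \<and> set (lift x s) \<noteq> {}) \<and>
        disjoint_family_on (\<lambda>s. set (lift x s)) (Sol P (kern x)) \<and>
        (\<Union>s\<in>Sol P (kern x). set (lift x s)) = Sol P x)"


section \<open>Enumeration of minimal matching cuts\<close>

text \<open>Graphs to be processed by programs have vertices \<open>0, \<dots>, n - 1\<close> with \<open>n \<ge> 1\<close> and
  are given by their adjacency matrix, a list of rows. An edge set \<open>M\<close> of such a graph is given by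
  the adjacency matrix of its spanning subgraph with edge set \<open>M\<close>.\<close>

definition adjacency_matrix :: "nat \<Rightarrow> nat set set \<Rightarrow> tree" where
  "adjacency_matrix n E =
     tree_of_list (map (\<lambda>u. tree_of_list (map (\<lambda>v. tree_of_bool ({u, v} \<in> E)) [0..<n])) [0..<n])"

lemma tree_of_list_eq_iff: "tree_of_list xs = tree_of_list ys \<longleftrightarrow> xs = ys"
proof (induction xs arbitrary: ys)
  case Nil
  show ?case by (cases ys) auto
next
  case (Cons x xs)
  then show ?case by (cases ys) auto
qed

lemma adjacency_matrix_inject:
  assumes "adjacency_matrix n E = adjacency_matrix m F"
    and "\<forall>e\<in>E. e \<subseteq> {..<n} \<and> card e = 2" and "\<forall>e\<in>F. e \<subseteq> {..<m} \<and> card e = 2"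
  shows "n = m \<and> E = F"
proof -
  have eq: "map (\<lambda>u. tree_of_list (map (\<lambda>v. tree_of_bool ({u, v} \<in> E)) [0..<n])) [0..<n] =
        map (\<lambda>u. tree_of_list (map (\<lambda>v. tree_of_bool ({u, v} \<in> F)) [0..<m])) [0..<m]"
    using assms(1) by (simp add: adjacency_matrix_def tree_of_list_eq_iff)
  then have nm: "n = m" by (metis length_map length_upt minus_nat.diff_0)
  have same: "{u, v} \<in> E \<longleftrightarrow> {u, v} \<in> F" if "u < n" "v < n" for u v
  proof -
    have "tree_of_list (map (\<lambda>v. tree_of_bool ({u, v} \<in> E)) [0..<n]) =
          tree_of_list (map (\<lambda>v. tree_of_bool ({u, v} \<in> F)) [0..<n])"
      using arg_cong[OF eq, of "\<lambda>xs. xs ! u"] \<open>u < n\<close> by (simp add: nm[symmetric] del: upt_Suc)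
    then have "map (\<lambda>v. tree_of_bool ({u, v} \<in> E)) [0..<n] =
               map (\<lambda>v. tree_of_bool ({u, v} \<in> F)) [0..<n]"
      by (simp only: tree_of_list_eq_iff)
    from arg_cong[OF this, of "\<lambda>xs. xs ! v"] \<open>v < n\<close>
    have "tree_of_bool ({u, v} \<in> E) = tree_of_bool ({u, v} \<in> F)" by simp
    then show ?thesis by (simp add: tree_of_bool_def split: if_splits)
  qed
  have "e \<in> E \<longleftrightarrow> e \<in> F" if sub: "e \<subseteq> {..<n}" and two: "card e = 2" for e
  proof -
    from two obtain u v where "e = {u, v}" unfolding card_2_iff by blast
    with sub same[of u v] show ?thesis by simp
  qed
  then have "E = F"
    using assms(2,3)[folded nm] by (intro set_eqI) metis
  with nm show ?thesis by simp
qed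

definition enum_minimal_mc :: "(nat graph, nat set set) enumeration_problem" where
  "enum_minimal_mc =
     \<lparr>Inst = {G. simple_graph G \<and> (\<exists>n. verts G = {..<n})},
      Sol = (\<lambda>G. {M. minimal_matching_cut G M}),
      param = modular_width,
      inst_enc = (\<lambda>G. adjacency_matrix (card (verts G)) (edges G)),
      sol_enc = (\<lambda>G M. adjacency_matrix (card (verts G)) M)\<rparr>"

end

theory Submission
  imports Defs
begin

text \<open>
  Call an edge strong if it lies in a triangle or in a \<open>K\<^bsub>2,3\<^esub>\<close>. No matching cut separates the ends
  of a strong edge, so every matching cut of a connected graph is a bipartition of the components
  of the strong edges (the classes of \<open>tied\<close>), and only the vertices with a neighbour in another
  class matter. In a part of size at least 3 of a modular partition such a vertex is pendant.
  The edge at a pendant vertex is a minimal matching cut on its own, so one pendant vertex can stand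
  for all of them, and the \<open>k\<close> parts contribute at most two vertices each. The kernel triples these
  vertices and turns each class into a clique, which cannot be separated since it has at least
  three vertices. In a disconnected graph the empty set is the only minimal matching cut, as in the
  edgeless graph on two vertices. The kernel is defined from adjacency by bounded quantification
  and reachability only, so no modular decomposition has to be computed.
\<close>

section \<open>Polynomial time\<close>

text \<open>The modular partition occurs only in the size bound, and only the outermost substitution
  is used. A part of size at most two has at most two kept vertices anyway; a larger one can only
  keep vertex 0 and the representative pendant vertex. This is why strong edges include K_{2,3}:
  three vertices of a module with two common outside neighbours span one, so an untied edge can
  leave a large part only if there is a single outside neighbour.

  Three is the least number of copies that turns a class with one kept vertex into a triangle.
  Original edges run only between first copies, so kernel edges joining different classes correspond
  one to one to graph edges between untied kept vertices.

  Cuts are compared as edge sets: all matching cuts that avoid the dropped pendant vertices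
  correspond to those of the kernel, and since the correspondence respects inclusion, so do the
  minimal ones. The delicate direction is from kernel to graph, where vertices without a copy have
  to be placed: they follow their class, and dropped pendant vertices, the only ones whose class has
  no copy, follow their neighbour.\<close>

definition poly_bounded :: "(tree \<Rightarrow> nat) \<Rightarrow> bool" where
  "poly_bounded T \<longleftrightarrow> (\<exists>p :: nat poly. \<forall>a. T a \<le> poly p (size a))"

text \<open>Natural coefficients make every polynomial monotone, so a bound on a size can be
  substituted into a bound on a running time.\<close>

lemma poly_mono_nat: "x \<le> y \<Longrightarrow> poly p x \<le> poly (p :: nat poly) y"
  by (induction p) (auto intro!: add_mono mult_mono)

lemma poly_bounded_const [intro]: "poly_bounded (\<lambda>_. k)"
  unfolding poly_bounded_def by (rule exI[of _ "[:k:]"]) simp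

lemma poly_bounded_size [intro]: "poly_bounded size"
  unfolding poly_bounded_def by (rule exI[of _ "[:0, 1:]"]) simp

lemma poly_bounded_add [intro]: "poly_bounded T \<Longrightarrow> poly_bounded U \<Longrightarrow> poly_bounded (\<lambda>a. T a + U a)"
  unfolding poly_bounded_def by (metis add_mono poly_add)

lemma poly_bounded_mult [intro]: "poly_bounded T \<Longrightarrow> poly_bounded U \<Longrightarrow> poly_bounded (\<lambda>a. T a * U a)"
  unfolding poly_bounded_def by (metis mult_le_mono poly_mult)

lemma poly_bounded_Suc [intro]: "poly_bounded T \<Longrightarrow> poly_bounded (\<lambda>a. Suc (T a))"
  using poly_bounded_add[OF poly_bounded_const[of 1]] by simp

lemma poly_bounded_poly: "poly_bounded T \<Longrightarrow> poly_bounded (\<lambda>a. poly p (T a))"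
  unfolding poly_bounded_def by (metis poly_mono_nat poly_pcompose)

lemma poly_bounded_mono: "poly_bounded T \<Longrightarrow> (\<And>a. U a \<le> T a) \<Longrightarrow> poly_bounded U"
  unfolding poly_bounded_def by (meson le_trans)

section \<open>Programs as functions on trees, and their composition\<close>

primrec store_of :: "tree list \<Rightarrow> store" where
  "store_of [] = (\<lambda>_. Leaf)"
| "store_of (x # xs) = case_nat x (store_of xs)"

primrec shift_expr :: "expr \<Rightarrow> expr" where
  "shift_expr (Var x) = Var (Suc x)"
| "shift_expr (Const a) = Const a"
| "shift_expr (Cons e e') = Cons (shift_expr e) (shift_expr e')"
| "shift_expr (Hd e) = Hd (shift_expr e)"
| "shift_expr (Tl e) = Tl (shift_expr e)"
| "shift_expr (Equal e e') = Equal (shift_expr e) (shift_expr e')"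

text \<open>A calling convention for a language without local variables: the renamed program leaves
  variable 0 alone, so a value parked there survives the call.\<close>

primrec shift :: "com \<Rightarrow> com" where
  "shift Skip = Skip"
| "shift (Assign x e) = Assign (Suc x) (shift_expr e)"
| "shift (Seq c c') = Seq (shift c) (shift c')"
| "shift (If e c c') = If (shift_expr e) (shift c) (shift c')"
| "shift (While e c) = While (shift_expr e) (shift c)"

lemma val_shift: "val (shift_expr e) (case_nat x s) = val e s"
  by (induction e) auto

lemma exec_shift: "exec c s t s' \<Longrightarrow> exec (shift c) (case_nat x s) t (case_nat x s')"
proof (induction rule: exec.induct)
  case (Assign y e s)
  have "case_nat x (s(y := val e s)) = (case_nat x s)(Suc y := val (shift_expr e) (case_nat x s))"
    by (auto simp: fun_eq_iff val_shift split: nat.split)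
  then show ?case
    using exec.Assign[of "Suc y" "shift_expr e" "case_nat x s"] by (simp only: val_shift shift.simps)
qed (simp_all only: shift.simps, (intro exec.intros; simp only: val_shift not_False_eq_True)+)

lemma exec_shift_store: "exec c (store_of xs) t (store_of ys) \<Longrightarrow>
    exec (shift c) (store_of (x # xs)) t (store_of (x # ys))"
  by (simp add: exec_shift)

lemma exec_Assign_eq: "s' = s(x := val e s) \<Longrightarrow> exec (Assign x e) s (1 + size (val e s)) s'"
  using exec.Assign by simp

text \<open>An assignment is charged the size of what it stores, so a time bound is also a bound on
  output length; without this, compositions would not stay polynomial.\<close>

lemma exec_size_bound: "exec c s t s' \<Longrightarrow> \<forall>x. size (s x) \<le> k \<Longrightarrow> size (s' x) \<le> k + t"
proof (induction arbitrary: k x rule: exec.induct)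
  case (Seq c s t s' c' t' s'')
  then show ?case by (metis add.assoc)
next
  case (WhileTrue e s c t s' t' s'')
  then have "size (s'' x) \<le> k + t + t'" by blast
  then show ?case by simp
qed (auto simp: trans_le_add1 intro: le_SucI)

text \<open>The run must start and end with a single occupied variable: scratch variables are
  cleared, so programs can be chained and shifted freely. Correctness is demanded on every tree, not
  only on encodings of graphs, which keeps the closure rules free of side conditions.\<close>

definition ptime :: "(tree \<Rightarrow> tree) \<Rightarrow> bool" where
  "ptime f \<longleftrightarrow> (\<exists>c T. poly_bounded T \<and>
     (\<forall>a. \<exists>t\<le>T a. exec c (store_of [a]) t (store_of [f a])))"

lemma ptimeI:
  assumes "poly_bounded T" "\<And>a. \<exists>t\<le>T a. exec c (store_of [a]) t (store_of [f a])"
  shows "ptime f"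
  using assms unfolding ptime_def by blast

lemma ptime_size:
  assumes "ptime f" shows "poly_bounded (\<lambda>a. size (f a))"
proof -
  obtain c T where T: "poly_bounded T" "\<And>a. \<exists>t\<le>T a. exec c (store_of [a]) t (store_of [f a])"
    using assms unfolding ptime_def by blast
  have "size (f a) \<le> size a + T a" for a
  proof -
    obtain t where t: "t \<le> T a" "exec c (store_of [a]) t (store_of [f a])" using T(2) by blast
    have "size (store_of [f a] 0) \<le> size a + t"
      by (rule exec_size_bound[OF t(2)]) (auto split: nat.split)
    then show ?thesis using t(1) by simp
  qed
  then show ?thesis
    by (rule poly_bounded_mono[OF poly_bounded_add[OF poly_bounded_size T(1)]])
qed

lemma poly_bounded_comp:
  assumes "poly_bounded T" "poly_bounded (\<lambda>a. size (f a))"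
  shows "poly_bounded (\<lambda>a. T (f a))"
proof -
  obtain p where "\<And>a. T a \<le> poly p (size a)" using assms(1) unfolding poly_bounded_def by blast
  then show ?thesis by (rule poly_bounded_mono[OF poly_bounded_poly[OF assms(2)]])
qed

lemma ptime_comp:
  assumes "ptime f" "ptime g" shows "ptime (\<lambda>a. f (g a))"
proof -
  obtain c T where c: "poly_bounded T" "\<And>a. \<exists>t\<le>T a. exec c (store_of [a]) t (store_of [f a])"
    using assms(1) unfolding ptime_def by blast
  obtain d U where d: "poly_bounded U" "\<And>a. \<exists>t\<le>U a. exec d (store_of [a]) t (store_of [g a])"
    using assms(2) unfolding ptime_def by blast
  show ?thesis
  proof (rule ptimeI[where c = "Seq d c"])
    show "poly_bounded (\<lambda>a. U a + T (g a))"
      using c(1) d(1) ptime_size[OF assms(2)] by (auto intro: poly_bounded_comp)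
    show "\<exists>t\<le>U a + T (g a). exec (Seq d c) (store_of [a]) t (store_of [f (g a)])" for a
      using c(2)[of "g a"] d(2)[of a] by (meson add_mono exec.Seq)
  qed
qed

lemma store_of_upd: "(store_of (x # xs))(0 := v) = store_of (v # xs)"
  by (auto simp: fun_eq_iff split: nat.split)

lemma ptime_assign:
  assumes "poly_bounded (\<lambda>a. size (val e (store_of [a])))"
  shows "ptime (\<lambda>a. val e (store_of [a]))"
proof (rule ptimeI[where c = "Assign 0 e"])
  show "poly_bounded (\<lambda>a. 1 + size (val e (store_of [a])))" using assms by auto
  show "\<exists>t\<le>1 + size (val e (store_of [a])).
      exec (Assign 0 e) (store_of [a]) t (store_of [val e (store_of [a])])" for a
    using exec_Assign_eq[of "store_of [val e (store_of [a])]" "store_of [a]" 0 e]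
    by (metis le_refl fun_upd_def store_of_upd)
qed

lemma ptime_id: "ptime (\<lambda>a. a)"
  using ptime_assign[of "Var 0"] by auto

lemma ptime_const: "ptime (\<lambda>_. k)"
  using ptime_assign[of "Const k"] by auto

lemma size_left_le: "size (left a) \<le> size a" and size_right_le: "size (right a) \<le> size a"
  by (cases a; simp)+

lemma ptime_left:
  assumes "ptime f" shows "ptime (\<lambda>a. left (f a))"
proof (rule ptime_comp[OF _ assms])
  show "ptime left"
    using ptime_assign[of "Hd (Var 0)"] poly_bounded_mono[OF poly_bounded_size size_left_le] by simp
qed

lemma ptime_right:
  assumes "ptime f" shows "ptime (\<lambda>a. right (f a))"
proof (rule ptime_comp[OF _ assms])
  show "ptime right"
    using ptime_assign[of "Tl (Var 0)"] poly_bounded_mono[OF poly_bounded_size size_right_le] by simp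
qed

text \<open>The subroutine call: the input is copied to variable 1 and the shifted program works on
  the copy, while variable 0 keeps the input for later calls.\<close>

lemma exec_save_run:
  assumes "exec c (store_of [a]) t (store_of [b])"
  shows "exec (Seq (Assign 1 (Var 0)) (shift c)) (store_of [a]) (1 + size a + t) (store_of [a, b])"
proof (rule exec.Seq[OF _ exec_shift_store[OF assms]])
  have "exec (Assign 1 (Var 0)) (store_of [a]) (1 + size (val (Var 0) (store_of [a]))) (store_of [a, a])"
    by (rule exec_Assign_eq) (auto simp: fun_eq_iff split: nat.split)
  then show "exec (Assign 1 (Var 0)) (store_of [a]) (1 + size a) (store_of [a, a])" by simp
qed

lemma exec_save_run2:
  assumes "exec c (store_of [a]) t (store_of [b])"
  shows "exec (Seq (Assign 2 (Var 0)) (shift (shift c))) (store_of [a, x]) (1 + size a + t)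
           (store_of [a, x, b])"
proof (rule exec.Seq[OF _ exec_shift_store[OF exec_shift_store[OF assms]]])
  have "exec (Assign 2 (Var 0)) (store_of [a, x]) (1 + size (val (Var 0) (store_of [a, x])))
      (store_of [a, x, a])"
    by (rule exec_Assign_eq) (auto simp: fun_eq_iff numeral_2_eq_2 split: nat.split)
  then show "exec (Assign 2 (Var 0)) (store_of [a, x]) (1 + size a) (store_of [a, x, a])" by simp
qed

lemma ptime_Node:
  assumes "ptime f" "ptime g" shows "ptime (\<lambda>a. Node (f a) (g a))"
proof -
  obtain c T where c: "poly_bounded T" "\<And>a. \<exists>t\<le>T a. exec c (store_of [a]) t (store_of [f a])"
    using assms(1) unfolding ptime_def by blast
  obtain d U where d: "poly_bounded U" "\<And>a. \<exists>t\<le>U a. exec d (store_of [a]) t (store_of [g a])"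
    using assms(2) unfolding ptime_def by blast
  let ?fin = "Seq (Assign 0 (Cons (Var 1) (Var 2))) (Seq (Assign 1 (Const Leaf)) (Assign 2 (Const Leaf)))"
  let ?prog = "Seq (Seq (Assign 1 (Var 0)) (shift c)) (Seq (Seq (Assign 2 (Var 0)) (shift (shift d))) ?fin)"
  have fin: "exec ?fin (store_of [a, x, y]) (size x + size y + 4) (store_of [Node x y])" for a x y
  proof -
    let ?s = "store_of [a, x, y]"
    have "exec ?fin ?s (1 + size (Node x y) + (1 + size Leaf + (1 + size Leaf)))
       (?s(0 := Node x y, 1 := Leaf, 2 := Leaf))"
      using exec.Assign[of 0 "Cons (Var 1) (Var 2)" ?s] exec.Assign[of 1 "Const Leaf" "?s(0 := Node x y)"]
        exec.Assign[of 2 "Const Leaf" "?s(0 := Node x y, 1 := Leaf)"]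
      by (intro exec.Seq) (auto simp: numeral_2_eq_2)
    moreover have "?s(0 := Node x y, 1 := Leaf, 2 := Leaf) = store_of [Node x y]"
      by (auto simp: fun_eq_iff numeral_2_eq_2 split: nat.split)
    ultimately show ?thesis by (simp add: add_ac numeral_eq_Suc)
  qed
  show ?thesis
  proof (rule ptimeI[where c = ?prog])
    show "poly_bounded (\<lambda>a. (1 + size a + T a) + ((1 + size a + U a) + (size (f a) + size (g a) + 4)))"
      using c(1) d(1) ptime_size[OF assms(1)] ptime_size[OF assms(2)]
      by (intro poly_bounded_add poly_bounded_const poly_bounded_size)
    fix a
    obtain t u where t: "t \<le> T a" "exec c (store_of [a]) t (store_of [f a])"
      and u: "u \<le> U a" "exec d (store_of [a]) u (store_of [g a])"
      using c(2) d(2) by meson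
    have "exec ?prog (store_of [a])
       ((1 + size a + t) + ((1 + size a + u) + (size (f a) + size (g a) + 4))) (store_of [Node (f a) (g a)])"
      by (rule exec.Seq[OF exec_save_run[OF t(2)] exec.Seq[OF exec_save_run2[OF u(2)] fin]])
    then show "\<exists>t\<le>(1 + size a + T a) + ((1 + size a + U a) + (size (f a) + size (g a) + 4)).
        exec ?prog (store_of [a]) t (store_of [Node (f a) (g a)])"
      using t(1) u(1) by (intro exI conjI) auto
  qed
qed

lemma ptime_eq:
  assumes "ptime f" "ptime g" shows "ptime (\<lambda>a. tree_of_bool (f a = g a))"
proof -
  have "size (tree_of_bool b) \<le> 1" for b by (simp add: tree_of_bool_def)
  then have "ptime (\<lambda>a. tree_of_bool (left a = right a))"
    using ptime_assign[of "Equal (Hd (Var 0)) (Tl (Var 0))"] poly_bounded_mono[OF poly_bounded_const[of 1]]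
    by simp
  from ptime_comp[OF this ptime_Node[OF assms]] show ?thesis by simp
qed

lemma ptime_If_tree:
  assumes "ptime h" "ptime f" "ptime g" shows "ptime (\<lambda>a. if h a \<noteq> Leaf then f a else g a)"
proof -
  obtain b S where b: "poly_bounded S" "\<And>a. \<exists>t\<le>S a. exec b (store_of [a]) t (store_of [h a])"
    using assms(1) unfolding ptime_def by blast
  obtain c T where c: "poly_bounded T" "\<And>a. \<exists>t\<le>T a. exec c (store_of [a]) t (store_of [f a])"
    using assms(2) unfolding ptime_def by blast
  obtain d U where d: "poly_bounded U" "\<And>a. \<exists>t\<le>U a. exec d (store_of [a]) t (store_of [g a])"
    using assms(3) unfolding ptime_def by blast
  let ?clr = "Assign 1 (Const Leaf)"
  let ?prog = "Seq (Seq (Assign 1 (Var 0)) (shift b)) (If (Var 1) (Seq ?clr c) (Seq ?clr d))"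
  let ?B = "\<lambda>a. (1 + size a + S a) + (1 + (1 + (T a + U a)))"
  have clr: "exec ?clr (store_of [a, x]) 1 (store_of [a])" for a x
    using exec_Assign_eq[of "store_of [a]" "store_of [a, x]" 1 "Const Leaf"]
    by (auto simp: fun_eq_iff split: nat.split)
  show ?thesis
  proof (rule ptimeI[where c = ?prog])
    show "poly_bounded ?B"
      using b(1) c(1) d(1) by (intro poly_bounded_add poly_bounded_const poly_bounded_size)
    fix a
    obtain s t u where s: "s \<le> S a" "exec b (store_of [a]) s (store_of [h a])"
      and t: "t \<le> T a" "exec c (store_of [a]) t (store_of [f a])"
      and u: "u \<le> U a" "exec d (store_of [a]) u (store_of [g a])"
      using b(2) c(2) d(2) by meson
    let ?r = "if h a \<noteq> Leaf then t else u"
    have "exec ?prog (store_of [a]) ((1 + size a + s) + (1 + (1 + ?r)))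
        (store_of [if h a \<noteq> Leaf then f a else g a])"
    proof (rule exec.Seq[OF exec_save_run[OF s(2)]], cases "h a = Leaf")
      case True
      then show "exec (If (Var 1) (Seq ?clr c) (Seq ?clr d)) (store_of [a, h a]) (1 + (1 + ?r))
          (store_of [if h a \<noteq> Leaf then f a else g a])"
        using exec.Seq[OF clr u(2)] by (intro exec.IfFalse) auto
    next
      case False
      then show "exec (If (Var 1) (Seq ?clr c) (Seq ?clr d)) (store_of [a, h a]) (1 + (1 + ?r))
          (store_of [if h a \<noteq> Leaf then f a else g a])"
        using exec.Seq[OF clr t(2)] by (intro exec.IfTrue) auto
    qed
    moreover have "(1 + size a + s) + (1 + (1 + ?r)) \<le> ?B a" using s(1) t(1) u(1) by auto
    ultimately show "\<exists>t\<le>?B a. exec ?prog (store_of [a]) t (store_of [if h a \<noteq> Leaf then f a else g a])"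
      by blast
  qed
qed

section \<open>Numbers as spines of trees, and bounded iteration\<close>

text \<open>Every tree is read as the length of its right spine, so that decoding is total.\<close>

primrec nat_of :: "tree \<Rightarrow> nat" where
  "nat_of Leaf = 0"
| "nat_of (Node a b) = Suc (nat_of b)"

lemma tree_of_nat_simps [simp]: "tree_of_nat 0 = Leaf" "tree_of_nat (Suc n) = Node Leaf (tree_of_nat n)"
  by (simp_all add: tree_of_nat_def)

lemma nat_of_tree_of_list [simp]: "nat_of (tree_of_list xs) = length xs"
  by (induction xs) auto

lemma nat_of_tree_of_nat [simp]: "nat_of (tree_of_nat n) = n"
  by (induction n) auto

lemma size_tree_of_nat [simp]: "size (tree_of_nat n) = n"
  by (induction n) auto

lemma nat_of_le_size: "nat_of a \<le> size a"
  by (induction a) auto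

text \<open>The only loop that is ever programmed; all later iteration reduces to it. Since
  \<open>foldr\<close> consumes the largest index first, the tree \<open>C a\<close> itself serves
  as counter: after removing its head, the length of its spine is the current index. The bound
  \<open>B\<close> on all intermediate results is essential, because iterating a polynomial step may
  otherwise produce values of exponential size.\<close>

lemma ptime_foldr_tree:
  assumes "ptime C" "ptime I" "ptime (\<lambda>e. F (left (left e)) (nat_of (right (left e))) (right e))"
    and B: "poly_bounded B" "\<And>a j. j \<le> nat_of (C a) \<Longrightarrow> size (foldr (F a) [j..<nat_of (C a)] (I a)) \<le> B a"
  shows "ptime (\<lambda>a. foldr (F a) [0..<nat_of (C a)] (I a))"
proof -
  let ?f = "\<lambda>e. F (left (left e)) (nat_of (right (left e))) (right e)"
  obtain b S where b: "poly_bounded S" "\<And>a. \<exists>t\<le>S a. exec b (store_of [a]) t (store_of [C a])"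
    using assms(1) unfolding ptime_def by blast
  obtain c T where c: "poly_bounded T" "\<And>a. \<exists>t\<le>T a. exec c (store_of [a]) t (store_of [I a])"
    using assms(2) unfolding ptime_def by blast
  obtain d U where d: "poly_bounded U" "\<And>a. \<exists>t\<le>U a. exec d (store_of [a]) t (store_of [?f a])"
    using assms(3) unfolding ptime_def by blast
  obtain p where p: "\<And>a. U a \<le> poly p (size a)" using d(1) unfolding poly_bounded_def by blast
  \<comment> \<open>Variable 0 holds the input, 1 the remaining counter, 2 the accumulator. Variable
    3 packs the three into the argument of \<open>d\<close>, which is shifted three times so as to
    work there.\<close>
  let ?body = "Seq (Assign 1 (Tl (Var 1))) (Seq (Assign 3 (Cons (Cons (Var 0) (Var 1)) (Var 2)))
     (Seq (shift (shift (shift d))) (Seq (Assign 2 (Var 3)) (Assign 3 (Const Leaf)))))"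
  let ?loop = "While (Var 1) ?body"
  let ?fin = "Seq (Assign 0 (Var 2)) (Assign 2 (Const Leaf))"
  let ?prog = "Seq (Seq (Assign 1 (Var 0)) (shift b))
     (Seq (Seq (Assign 2 (Var 0)) (shift (shift c))) (Seq ?loop ?fin))"
  \<comment> \<open>\<open>D a\<close> bounds the packed argument, whose two inner nodes account for
    the 2; \<open>K a\<close> bounds one round of the loop including its test.\<close>
  define D where "D a = size a + size (C a) + B a + 2" for a
  define K where "K a = 6 + 3 * D a + poly p (D a)" for a
  have body: "\<exists>u \<le> 5 + size y + (size a + size y + size acc + 2) + U (Node (Node a y) acc) + size (F a (nat_of y) acc).
       exec ?body (store_of [a, Node z y, acc]) u (store_of [a, y, F a (nat_of y) acc])"
    for a y z acc
  proof -
    let ?e = "Node (Node a y) acc" and ?r = "F a (nat_of y) acc"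
    obtain u where u: "u \<le> U ?e" "exec d (store_of [?e]) u (store_of [?r])"
      using d(2)[of ?e] by auto
    have 1: "exec (Assign 1 (Tl (Var 1))) (store_of [a, Node z y, acc]) (1 + size y) (store_of [a, y, acc])"
      using exec_Assign_eq[of "store_of [a, y, acc]" "store_of [a, Node z y, acc]" 1 "Tl (Var 1)"]
      by (auto simp: fun_eq_iff split: nat.split)
    have 2: "exec (Assign 3 (Cons (Cons (Var 0) (Var 1)) (Var 2))) (store_of [a, y, acc]) (1 + size ?e)
        (store_of [a, y, acc, ?e])"
      using exec_Assign_eq[of "store_of [a, y, acc, ?e]" "store_of [a, y, acc]" 3 "Cons (Cons (Var 0) (Var 1)) (Var 2)"]
      by (auto simp: fun_eq_iff numeral_eq_Suc split: nat.split)
    have 3: "exec (shift (shift (shift d))) (store_of [a, y, acc, ?e]) u (store_of [a, y, acc, ?r])"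
      by (intro exec_shift_store u(2))
    have 4: "exec (Assign 2 (Var 3)) (store_of [a, y, acc, ?r]) (1 + size ?r) (store_of [a, y, ?r, ?r])"
      using exec_Assign_eq[of "store_of [a, y, ?r, ?r]" "store_of [a, y, acc, ?r]" 2 "Var 3"]
      by (auto simp: fun_eq_iff numeral_eq_Suc split: nat.split)
    have 5: "exec (Assign 3 (Const Leaf)) (store_of [a, y, ?r, ?r]) 1 (store_of [a, y, ?r])"
      using exec_Assign_eq[of "store_of [a, y, ?r]" "store_of [a, y, ?r, ?r]" 3 "Const Leaf"]
      by (auto simp: fun_eq_iff numeral_eq_Suc split: nat.split)
    show ?thesis
      by (rule exI, rule conjI[rotated], rule exec.Seq[OF 1 exec.Seq[OF 2 exec.Seq[OF 3 exec.Seq[OF 4 5]]]])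
        (use u(1) in simp)
  qed
  have loop: "\<exists>u \<le> 1 + nat_of x * K a.
       exec ?loop (store_of [a, x, foldr (F a) [nat_of x..<nat_of (C a)] (I a)]) u
         (store_of [a, Leaf, foldr (F a) [0..<nat_of (C a)] (I a)])"
    if "nat_of x \<le> nat_of (C a)" "size x \<le> size (C a)" for a x
    using that
  proof (induction x)
    case Leaf
    show ?case
      by (rule exI[of _ 1]) (use exec.WhileFalse[of "Var 1" "store_of [a, Leaf, x]" ?body for x] in auto)
  next
    case (Node z y)
    let ?acc = "foldr (F a) [Suc (nat_of y)..<nat_of (C a)] (I a)"
    let ?acc' = "foldr (F a) [nat_of y..<nat_of (C a)] (I a)"
    have acc': "?acc' = F a (nat_of y) ?acc"
      using Node.prems by (simp add: upt_conv_Cons)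
    obtain v where v: "v \<le> 1 + nat_of y * K a"
      "exec ?loop (store_of [a, y, ?acc']) v (store_of [a, Leaf, foldr (F a) [0..<nat_of (C a)] (I a)])"
      using Node by auto
    obtain u where u: "u \<le> 5 + size y + (size a + size y + size ?acc + 2) + U (Node (Node a y) ?acc) + size ?acc'"
      "exec ?body (store_of [a, Node z y, ?acc]) u (store_of [a, y, ?acc'])"
      using body[of y a ?acc z] acc' by auto
    have sz: "size ?acc \<le> B a" "size ?acc' \<le> B a" using B(2) Node.prems by auto
    have "size (Node (Node a y) ?acc) \<le> D a" using sz Node.prems by (simp add: D_def)
    then have "U (Node (Node a y) ?acc) \<le> poly p (D a)" using p poly_mono_nat le_trans by blast
    then have "1 + u \<le> K a" using u(1) sz Node.prems by (simp add: K_def D_def)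
    then have "1 + u + v \<le> 1 + nat_of (Node z y) * K a" using v(1) by simp
    moreover have "exec ?loop (store_of [a, Node z y, ?acc]) (1 + u + v)
        (store_of [a, Leaf, foldr (F a) [0..<nat_of (C a)] (I a)])"
      by (rule exec.WhileTrue[OF _ u(2) v(2)]) simp
    ultimately show ?case by auto
  qed
  have fin: "exec ?fin (store_of [a, Leaf, x]) (1 + size x + 1) (store_of [x])" for a x
  proof (rule exec.Seq)
    show "exec (Assign 0 (Var 2)) (store_of [a, Leaf, x]) (1 + size x) (store_of [x, Leaf, x])"
      using exec_Assign_eq[of "store_of [x, Leaf, x]" "store_of [a, Leaf, x]" 0 "Var 2"]
      by (auto simp: fun_eq_iff numeral_eq_Suc split: nat.split)
    show "exec (Assign 2 (Const Leaf)) (store_of [x, Leaf, x]) 1 (store_of [x])"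
      using exec_Assign_eq[of "store_of [x]" "store_of [x, Leaf, x]" 2 "Const Leaf"]
      by (auto simp: fun_eq_iff numeral_eq_Suc split: nat.split)
  qed
  let ?B = "\<lambda>a. (1 + size a + S a) + ((1 + size a + T a) + ((1 + size (C a) * K a) + (1 + B a + 1)))"
  show ?thesis
  proof (rule ptimeI[where c = ?prog])
    have D: "poly_bounded D" unfolding D_def
      using B(1) ptime_size[OF assms(1)] by (intro poly_bounded_add poly_bounded_const poly_bounded_size)
    then have "poly_bounded K" unfolding K_def
      by (intro poly_bounded_add poly_bounded_mult poly_bounded_const poly_bounded_poly)
    then show "poly_bounded ?B"
      using b(1) c(1) B(1) ptime_size[OF assms(1)]
      by (intro poly_bounded_add poly_bounded_mult poly_bounded_const poly_bounded_size)
    fix a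
    let ?r = "foldr (F a) [0..<nat_of (C a)] (I a)"
    obtain s t where s: "s \<le> S a" "exec b (store_of [a]) s (store_of [C a])"
      and t: "t \<le> T a" "exec c (store_of [a]) t (store_of [I a])"
      using b(2) c(2) by meson
    obtain u where u: "u \<le> 1 + nat_of (C a) * K a"
      "exec ?loop (store_of [a, C a, I a]) u (store_of [a, Leaf, ?r])"
      using loop[of "C a" a] by auto
    have "nat_of (C a) * K a \<le> size (C a) * K a" using nat_of_le_size by (rule mult_le_mono1)
    moreover have "size ?r \<le> B a" using B(2)[of 0 a] by simp
    ultimately have "(1 + size a + s) + ((1 + size a + t) + (u + (1 + size ?r + 1))) \<le> ?B a"
      using s(1) t(1) u(1) by linarith
    moreover have "exec ?prog (store_of [a]) ((1 + size a + s) + ((1 + size a + t) + (u + (1 + size ?r + 1)))) (store_of [?r])"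
      by (rule exec.Seq[OF exec_save_run[OF s(2)] exec.Seq[OF exec_save_run2[OF t(2)] exec.Seq[OF u(2) fin]]])
    ultimately show "\<exists>t\<le>?B a. exec ?prog (store_of [a]) t (store_of [?r])" by blast
  qed
qed

section \<open>Predicates, numbers and lists computable in polynomial time\<close>

definition pbool :: "(tree \<Rightarrow> bool) \<Rightarrow> bool" where
  "pbool P \<longleftrightarrow> ptime (\<lambda>a. tree_of_bool (P a))"

definition pnat :: "(tree \<Rightarrow> nat) \<Rightarrow> bool" where
  "pnat f \<longleftrightarrow> ptime (\<lambda>a. tree_of_nat (f a))"

lemma tree_of_bool_eq_Leaf [simp]: "tree_of_bool b = Leaf \<longleftrightarrow> \<not> b"
  by (simp add: tree_of_bool_def)

lemma size_tree_of_bool_le: "size (tree_of_bool b) \<le> 1"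
  by (simp add: tree_of_bool_def)

lemma ptime_If:
  assumes "pbool P" "ptime f" "ptime g" shows "ptime (\<lambda>a. if P a then f a else g a)"
  using ptime_If_tree[of "\<lambda>a. tree_of_bool (P a)" f g] assms by (simp add: pbool_def cong: if_cong)

lemma pbool_eq_tree: "ptime f \<Longrightarrow> ptime g \<Longrightarrow> pbool (\<lambda>a. f a = g a)"
  unfolding pbool_def by (rule ptime_eq)

lemma pbool_const: "pbool (\<lambda>_. b)"
  unfolding pbool_def by (rule ptime_const)

lemma pbool_If:
  assumes "pbool P" "pbool Q" "pbool R" shows "pbool (\<lambda>a. if P a then Q a else R a)"
  using ptime_If[of P "\<lambda>a. tree_of_bool (Q a)" "\<lambda>a. tree_of_bool (R a)"] assms
  by (simp add: pbool_def if_distrib cong: if_cong)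

lemma pbool_not:
  assumes "pbool P" shows "pbool (\<lambda>a. \<not> P a)"
proof -
  have "(\<lambda>a. \<not> P a) = (\<lambda>a. if P a then False else True)" by auto
  then show ?thesis using pbool_If[OF assms pbool_const pbool_const] by (simp only:)
qed

lemma pbool_conj:
  assumes "pbool P" "pbool Q" shows "pbool (\<lambda>a. P a \<and> Q a)"
proof -
  have "(\<lambda>a. P a \<and> Q a) = (\<lambda>a. if P a then Q a else False)" by auto
  then show ?thesis using pbool_If[OF assms pbool_const] by (simp only:)
qed

lemma pbool_disj:
  assumes "pbool P" "pbool Q" shows "pbool (\<lambda>a. P a \<or> Q a)"
proof -
  have "(\<lambda>a. P a \<or> Q a) = (\<lambda>a. if P a then True else Q a)" by auto
  then show ?thesis using pbool_If[OF assms(1) pbool_const assms(2)] by (simp only:)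
qed

lemma pbool_imp:
  assumes "pbool P" "pbool Q" shows "pbool (\<lambda>a. P a \<longrightarrow> Q a)"
proof -
  have "(\<lambda>a. P a \<longrightarrow> Q a) = (\<lambda>a. if P a then Q a else True)" by auto
  then show ?thesis using pbool_If[OF assms pbool_const] by (simp only:)
qed

lemma pnat_const: "pnat (\<lambda>_. k)"
  unfolding pnat_def by (rule ptime_const)

lemma pbool_eq_nat:
  assumes "pnat f" "pnat g" shows "pbool (\<lambda>a. f a = g a)"
proof -
  have "tree_of_nat m = tree_of_nat k \<longleftrightarrow> m = k" for m k by (metis nat_of_tree_of_nat)
  then show ?thesis
    using pbool_eq_tree[of "\<lambda>a. tree_of_nat (f a)" "\<lambda>a. tree_of_nat (g a)"] assms by (simp add: pnat_def)
qed

text \<open>A spine may carry arbitrary labels; the loop rebuilds it with \<open>Leaf\<close>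
  labels, which gives the canonical numeral. For this the counter of \<open>ptime_foldr_tree\<close>
  has to be an arbitrary tree.\<close>

lemma pnat_nat_of:
  assumes "ptime f" shows "pnat (\<lambda>a. nat_of (f a))"
proof -
  have eq: "foldr (\<lambda>_. Node Leaf) [j..<n] Leaf = tree_of_nat (n - j)" for j n
    by (induction "n - j" arbitrary: j) (auto simp: upt_rec Suc_diff_Suc[symmetric])
  have "ptime (\<lambda>a. foldr (\<lambda>_. Node Leaf) [0..<nat_of (f a)] Leaf)"
  proof (rule ptime_foldr_tree[OF assms ptime_const])
    show "ptime (\<lambda>e. Node Leaf (right e))" by (intro ptime_Node ptime_const ptime_right ptime_id)
    show "poly_bounded (\<lambda>a. size (f a))" using assms by (rule ptime_size)
    show "size (foldr (\<lambda>_. Node Leaf) [j..<nat_of (f a)] Leaf) \<le> size (f a)" for a j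
      using nat_of_le_size[of "f a"] unfolding eq by simp
  qed
  then show ?thesis unfolding pnat_def eq by simp
qed

lemma pnat_bounded: "pnat N \<Longrightarrow> poly_bounded N"
  unfolding pnat_def using ptime_size[of "\<lambda>a. tree_of_nat (N a)"] by simp

lemma ptime_foldr:
  assumes "pnat N" "ptime I" "ptime (\<lambda>e. F (left (left e)) (nat_of (right (left e))) (right e))"
    and "poly_bounded B" "\<And>a j. j \<le> N a \<Longrightarrow> size (foldr (F a) [j..<N a] (I a)) \<le> B a"
  shows "ptime (\<lambda>a. foldr (F a) [0..<N a] (I a))"
  using ptime_foldr_tree[of "\<lambda>a. tree_of_nat (N a)" I F B] assms by (simp add: pnat_def)

text \<open>The convention for bound variables: the body of a quantifier is a function of a pair
  \<open>e\<close>, with the outer input on the left and the index on the right. Nested binders give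
  nested pairs, and this rule evaluates a body in any such environment.\<close>

lemma ptime_comp_env:
  assumes "ptime (\<lambda>e. f (left e) (nat_of (right e)))" "ptime u" "ptime v"
  shows "ptime (\<lambda>a. f (u a) (nat_of (v a)))"
  using ptime_comp[OF assms(1) ptime_Node[OF assms(2,3)]] by simp

lemmas pbool_comp_env = ptime_comp_env[where f = "\<lambda>a i. tree_of_bool (P a i)" for P, folded pbool_def]

lemma pbool_ex:
  assumes "pnat N" "pbool (\<lambda>e. P (left e) (nat_of (right e)))"
  shows "pbool (\<lambda>a. \<exists>i<N a. P a i)"
proof -
  let ?F = "\<lambda>a i acc. if P a i then tree_of_bool True else acc"
  have eq: "foldr (?F a) [j..<n] (tree_of_bool False) = tree_of_bool (\<exists>i. j \<le> i \<and> i < n \<and> P a i)" for a j n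
  proof (induction "n - j" arbitrary: j)
    case 0
    then show ?case by (auto simp: tree_of_bool_def)
  next
    case (Suc k)
    have "(\<exists>i. j \<le> i \<and> i < n \<and> P a i) \<longleftrightarrow> P a j \<or> (\<exists>i. Suc j \<le> i \<and> i < n \<and> P a i)"
      using Suc.hyps(2) by (metis Suc_leD le_antisym not_less_eq_eq order_refl zero_less_Suc zero_less_diff)
    then show ?case using Suc by (subst upt_rec) (auto simp: Suc.hyps(1)[of "Suc j"])
  qed
  have "ptime (\<lambda>a. foldr (?F a) [0..<N a] (tree_of_bool False))"
  proof (rule ptime_foldr[OF assms(1) ptime_const _ poly_bounded_const[of 1]])
    show "ptime (\<lambda>e. ?F (left (left e)) (nat_of (right (left e))) (right e))"
      by (intro ptime_If pbool_comp_env[OF assms(2)] ptime_left ptime_right ptime_const ptime_id)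
  qed (unfold eq, rule size_tree_of_bool_le)
  then show ?thesis unfolding pbool_def eq by simp
qed

lemma pbool_all:
  assumes "pnat N" "pbool (\<lambda>e. P (left e) (nat_of (right e)))"
  shows "pbool (\<lambda>a. \<forall>i<N a. P a i)"
  using pbool_not[OF pbool_ex[OF assms(1), of "\<lambda>a i. \<not> P a i"]] pbool_not[OF assms(2)] by simp

lemma tree_of_list_append: "tree_of_list (xs @ ys) = foldr Node xs (tree_of_list ys)"
  by (induction xs) auto

text \<open>The tail \<open>l a\<close> is the initial accumulator, so appending costs no further
  loop; the three consecutive copies in \<open>origin\<close> are built this way.\<close>

lemma ptime_map_filter:
  assumes "pnat N" "pbool (\<lambda>e. P (left e) (nat_of (right e)))"
    and f: "ptime (\<lambda>e. f (left e) (nat_of (right e)))" and "ptime (\<lambda>a. tree_of_list (l a))"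
  shows "ptime (\<lambda>a. tree_of_list (map (f a) (filter (P a) [0..<N a]) @ l a))"
proof -
  let ?F = "\<lambda>a i acc. if P a i then Node (f a i) acc else acc"
  obtain p where p: "\<And>e. size (f (left e) (nat_of (right e))) \<le> poly p (size e)"
    using ptime_size[OF f] unfolding poly_bounded_def by blast
  \<comment> \<open>An entry is computed from the pair of \<open>a\<close> and an index below
    \<open>N a\<close>, whose size is less than the argument of \<open>p\<close> here.\<close>
  define D where "D a = poly p (size a + N a + 1)" for a
  have f_le: "size (f a i) \<le> D a" if "i < N a" for a i
  proof -
    have "size (f a i) \<le> poly p (size (Node a (tree_of_nat i)))" using p[of "Node a (tree_of_nat i)"] by simp
    also have "\<dots> \<le> D a" unfolding D_def using that by (intro poly_mono_nat) simp
    finally show ?thesis .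
  qed
  have size: "size (foldr (?F a) xs t) \<le> length xs * (D a + 1) + size t" if "set xs \<subseteq> {..<N a}" for a xs t
    using that
  proof (induction xs)
    case (Cons i xs)
    then have "size (f a i) \<le> D a" using f_le by simp
    with Cons show ?case by auto
  qed simp
  have eq: "foldr (?F a) xs t = foldr Node (map (f a) (filter (P a) xs)) t" for a xs t
    by (induction xs) auto
  have "ptime (\<lambda>a. foldr (?F a) [0..<N a] (tree_of_list (l a)))"
  proof (rule ptime_foldr[OF assms(1) assms(4)])
    show "ptime (\<lambda>e. ?F (left (left e)) (nat_of (right (left e))) (right e))"
      by (intro ptime_If pbool_comp_env[OF assms(2)] ptime_Node ptime_comp_env[OF f]
          ptime_left ptime_right ptime_const ptime_id)
    have "poly_bounded D" unfolding D_def using pnat_bounded[OF assms(1)]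
      by (intro poly_bounded_poly poly_bounded_add poly_bounded_size poly_bounded_const)
    then show "poly_bounded (\<lambda>a. N a * (D a + 1) + size (tree_of_list (l a)))"
      using pnat_bounded[OF assms(1)] ptime_size[OF assms(4)]
      by (intro poly_bounded_add poly_bounded_mult poly_bounded_const)
    show "size (foldr (?F a) [j..<N a] (tree_of_list (l a))) \<le> N a * (D a + 1) + size (tree_of_list (l a))" for a j
    proof -
      have "size (foldr (?F a) [j..<N a] (tree_of_list (l a))) \<le>
          length [j..<N a] * (D a + 1) + size (tree_of_list (l a))"
        by (rule size) auto
      also have "\<dots> \<le> N a * (D a + 1) + size (tree_of_list (l a))"
        by (intro add_mono mult_right_mono) auto
      finally show ?thesis .
    qed
  qed
  then show ?thesis by (simp only: eq tree_of_list_append)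
qed

lemma ptime_filter_map:
  assumes "pnat N" "pbool (\<lambda>e. P (left e) (nat_of (right e)))"
    and f: "ptime (\<lambda>e. f (left e) (nat_of (right e)))"
  shows "ptime (\<lambda>a. tree_of_list (map (f a) (filter (P a) [0..<N a])))"
  using ptime_map_filter[OF assms, of "\<lambda>_. []"] ptime_const by simp

lemma ptime_map:
  assumes "pnat N" "ptime (\<lambda>e. f (left e) (nat_of (right e)))"
  shows "ptime (\<lambda>a. tree_of_list (map (f a) [0..<N a]))"
  using ptime_filter_map[OF assms(1) pbool_const[of True] assms(2)] by simp

primrec nth_tree :: "tree \<Rightarrow> nat \<Rightarrow> tree" where
  "nth_tree t 0 = left t"
| "nth_tree t (Suc i) = nth_tree (right t) i"

lemma nth_tree_list: "nth_tree (tree_of_list xs) i = (if i < length xs then xs ! i else Leaf)"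
proof (induction i arbitrary: xs)
  case 0
  show ?case by (cases xs) auto
next
  case (Suc i)
  have "nth_tree Leaf j = Leaf" for j by (induction j) auto
  with Suc show ?case by (cases xs) auto
qed

lemma ptime_nth_tree:
  assumes "ptime t" "pnat i" shows "ptime (\<lambda>a. nth_tree (t a) (i a))"
proof -
  let ?F = "\<lambda>_ :: tree. \<lambda>_ :: nat. right"
  have eq: "foldr (\<lambda>_. right) xs t = (right ^^ length xs) t" for xs :: "nat list" and t
    by (induction xs) auto
  have nth: "nth_tree t i = left ((right ^^ i) t)" for t i
    by (induction i arbitrary: t) (auto simp: funpow_swap1)
  have size: "size ((right ^^ i) t) \<le> size t" for t i
    by (induction i) (auto intro: le_trans[OF size_right_le])
  have "ptime (\<lambda>a. foldr (?F a) [0..<i a] (t a))"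
  proof (rule ptime_foldr[OF assms(2,1)])
    show "ptime (\<lambda>e. right (right e))" by (intro ptime_right ptime_id)
    show "poly_bounded (\<lambda>a. size (t a))" using assms(1) by (rule ptime_size)
  qed (simp add: eq size)
  then show ?thesis unfolding nth by (intro ptime_left) (simp add: eq)
qed

lemma pnat_foldr:
  assumes "pnat N" "pnat I" "pnat (\<lambda>e. F (left (left e)) (nat_of (right (left e))) (nat_of (right e)))"
    and "poly_bounded B" "\<And>a j. j \<le> N a \<Longrightarrow> foldr (F a) [j..<N a] (I a) \<le> B a"
  shows "pnat (\<lambda>a. foldr (F a) [0..<N a] (I a))"
proof -
  let ?F = "\<lambda>a i acc. tree_of_nat (F a i (nat_of acc))"
  have eq: "foldr (?F a) xs (tree_of_nat x) = tree_of_nat (foldr (F a) xs x)" for a xs x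
    by (induction xs) auto
  have "ptime (\<lambda>a. foldr (?F a) [0..<N a] (tree_of_nat (I a)))"
    by (rule ptime_foldr[where B = B]) (use assms in \<open>auto simp: pnat_def eq\<close>)
  then show ?thesis unfolding pnat_def eq .
qed

lemma pnat_add:
  assumes "pnat f" "pnat g" shows "pnat (\<lambda>a. f a + g a)"
proof -
  have eq: "foldr (\<lambda>_. Suc) xs x = length xs + x" for xs :: "nat list" and x
    by (induction xs) auto
  have Suc: "pnat (\<lambda>e. Suc (nat_of (right e)))"
    using pnat_nat_of[OF ptime_Node[OF ptime_const[of Leaf] ptime_right[OF ptime_id]]] by simp
  have "pnat (\<lambda>a. foldr (\<lambda>_. Suc) [0..<f a] (g a))"
    by (rule pnat_foldr[OF assms Suc, where B = "\<lambda>a. f a + g a"])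
      (use pnat_bounded[OF assms(1)] pnat_bounded[OF assms(2)] in \<open>auto simp: eq\<close>)
  then show ?thesis by (simp add: eq)
qed

lemma pnat_mult:
  assumes "pnat f" "pnat g" shows "pnat (\<lambda>a. f a * g a)"
proof -
  have eq: "foldr (\<lambda>_. (+) y) xs 0 = length xs * y" for xs :: "nat list" and y :: nat
    by (induction xs) auto
  have g: "pnat (\<lambda>e. g (left (left e)))"
    using ptime_comp[of "\<lambda>a. tree_of_nat (g a)" "\<lambda>e. left (left e)"] assms(2)
    by (simp add: pnat_def ptime_left ptime_id)
  have "pnat (\<lambda>a. foldr (\<lambda>_. (+) (g a)) [0..<f a] 0)"
    by (rule pnat_foldr[OF assms(1) pnat_const pnat_add[OF g pnat_nat_of[OF ptime_right[OF ptime_id]]],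
        where B = "\<lambda>a. f a * g a"])
      (use pnat_bounded[OF assms(1)] pnat_bounded[OF assms(2)] in \<open>auto simp: eq\<close>)
  then show ?thesis by (simp add: eq)
qed

section \<open>Reachability\<close>

definition restricted :: "nat \<Rightarrow> (nat \<Rightarrow> nat \<Rightarrow> bool) \<Rightarrow> (nat \<times> nat) set" where
  "restricted n r = {(u, v). u < n \<and> v < n \<and> r u v}"

text \<open>Breadth-first search: the set of vertices reached so far is a list of \<open>N a\<close>
  bits, and each round adds all successors. The list never grows, so the iteration meets the size
  condition of \<open>ptime_foldr\<close>.\<close>

lemma pbool_rtrancl:
  assumes N: "pnat N" and u: "pnat u" and v: "pnat v"
    and r: "pbool (\<lambda>e. r (left (left e)) (nat_of (right (left e))) (nat_of (right e)))"
  shows "pbool (\<lambda>a. (u a, v a) \<in> (restricted (N a) (r a))\<^sup>*)"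
proof -
  define enc where "enc n X = tree_of_list (map (\<lambda>i. tree_of_bool (i \<in> X)) [0..<n])" for n and X :: "nat set"
  have mem: "nth_tree (enc n X) i \<noteq> Leaf \<longleftrightarrow> i < n \<and> i \<in> X" for n X i
    by (auto simp: enc_def nth_tree_list)
  have size_list: "size (tree_of_list (map (\<lambda>i. tree_of_bool (P i)) xs)) \<le> 2 * length xs" for xs :: "nat list" and P
    by (induction xs) (auto simp: tree_of_bool_def)
  define step where "step a t = tree_of_list (map (\<lambda>j. tree_of_bool
      (nth_tree t j \<noteq> Leaf \<or> (\<exists>i<N a. nth_tree t i \<noteq> Leaf \<and> r a i j))) [0..<N a])" for a t
  have step: "step a (enc (N a) X) = enc (N a) ((Id \<union> restricted (N a) (r a)) `` X)" for a X
    unfolding step_def enc_def[of _ "_ `` _"] mem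
    by (intro arg_cong[of _ _ tree_of_list] map_cong arg_cong[of _ _ tree_of_bool]) (auto simp: restricted_def)
  have pow: "(step a ^^ k) (enc (N a) {x}) = enc (N a) (((Id \<union> restricted (N a) (r a)) ^^ k) `` {x})" for a k x
  proof (induction k)
    case (Suc k)
    then show ?case by (simp only: funpow.simps relpow.simps o_apply step relcomp_Image)
  qed simp
  \<comment> \<open>The closure of a finite relation is exhausted by powers up to its number of
    pairs, here at most \<open>n * n\<close>. Adding \<open>Id\<close> makes the powers increase, so
    the last one suffices.\<close>
  have rtrancl: "(Id \<union> restricted n s) ^^ (n * n) = (restricted n s)\<^sup>*" for n s
  proof
    let ?R = "restricted n s"
    have sub: "?R \<subseteq> {..<n} \<times> {..<n}" by (auto simp: restricted_def)
    then have fin: "finite ?R" by (rule finite_subset) simp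
    have "card ?R \<le> n * n" using card_mono[OF _ sub] by simp
    have inc: "(Id \<union> ?R) ^^ k \<subseteq> (Id \<union> ?R) ^^ l" if "k \<le> l" for k l :: nat
      using that by (induction l rule: dec_induct) auto
    have "?R ^^ k \<subseteq> (Id \<union> ?R) ^^ k" for k by (induction k) auto
    then have "?R ^^ k \<subseteq> (Id \<union> ?R) ^^ (n * n)" if "k \<le> card ?R" for k
      using inc[of k "n * n"] that \<open>card ?R \<le> n * n\<close> by (meson le_trans subset_trans)
    then show "?R\<^sup>* \<subseteq> (Id \<union> ?R) ^^ (n * n)" unfolding rtrancl_finite_eq_relpow[OF fin] by blast
    have "(Id \<union> ?R) ^^ k \<subseteq> ?R\<^sup>*" for k
      by (induction k) (auto intro: rtrancl_into_rtrancl)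
    then show "(Id \<union> ?R) ^^ (n * n) \<subseteq> ?R\<^sup>*" .
  qed
  let ?step = "\<lambda>e. step (left (left e)) (right e)"
  have pstep: "ptime (\<lambda>e. step (left (left e)) (right e))"
  proof -
    have N': "pnat (\<lambda>e. N (f e))" if "ptime f" for f
      using ptime_comp[of "\<lambda>a. tree_of_nat (N a)" f] N that by (simp add: pnat_def)
    have r': "pbool (\<lambda>e. r (f e) (nat_of (g e)) (nat_of (h e)))" if "ptime f" "ptime g" "ptime h" for f g h
      using ptime_comp[OF r[unfolded pbool_def] ptime_Node[OF ptime_Node[OF that(1,2)] that(3)]]
      by (simp add: pbool_def)
    show ?thesis unfolding step_def
      by (intro ptime_map N' pbool_def[THEN iffD1] pbool_disj pbool_ex pbool_conj pbool_not pbool_eq_tree r'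
          ptime_nth_tree pnat_nat_of ptime_left ptime_right ptime_const ptime_id)
  qed
  have fold: "foldr (\<lambda>_. f) xs t = (f ^^ length xs) t" for f :: "tree \<Rightarrow> tree" and xs :: "nat list" and t
    by (induction xs) auto
  have "ptime (\<lambda>a. foldr (\<lambda>_. step a) [0..<N a * N a] (enc (N a) {u a}))"
  proof (rule ptime_foldr[OF pnat_mult[OF N N] _ pstep])
    have "pnat (\<lambda>e. u (left e))"
      using ptime_comp[of "\<lambda>a. tree_of_nat (u a)" left] u ptime_left[OF ptime_id] by (simp add: pnat_def)
    then show "ptime (\<lambda>a. enc (N a) {u a})" unfolding enc_def singleton_iff
      by (intro ptime_map N pbool_def[THEN iffD1] pbool_eq_nat pnat_nat_of ptime_right ptime_id)
    show "poly_bounded (\<lambda>a. 2 * N a)" using pnat_bounded[OF N] by auto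
    show "size (foldr (\<lambda>_. step a) [j..<N a * N a] (enc (N a) {u a})) \<le> 2 * N a" for a j
      unfolding fold pow unfolding enc_def using size_list by (rule le_trans) simp
  qed
  then have "ptime (\<lambda>a. enc (N a) ((restricted (N a) (r a))\<^sup>* `` {u a}))"
    unfolding fold by (simp add: pow rtrancl)
  \<comment> \<open>The bits cover only indices below \<open>N a\<close>; the test
    \<open>u a = v a\<close> catches the reflexive pairs beyond them.\<close>
  then have "pbool (\<lambda>a. u a = v a \<or> nth_tree (enc (N a) ((restricted (N a) (r a))\<^sup>* `` {u a})) (v a) \<noteq> Leaf)"
    by (intro pbool_disj pbool_not pbool_eq_nat pbool_eq_tree ptime_nth_tree u v ptime_const)
  moreover have "(x, y) \<in> (restricted n s)\<^sup>* \<longleftrightarrow> x = y \<or> y < n \<and> (x, y) \<in> (restricted n s)\<^sup>*" for x y n s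
    by (auto elim: rtranclE simp: restricted_def)
  ultimately show ?thesis unfolding mem by (simp add: Image_singleton_iff)
qed

section \<open>Modular partitions, cuts and the kernel\<close>

lemma mw_constructible_wf:
  "mw_constructible k H \<Longrightarrow> verts H \<noteq> {} \<and> (\<forall>e\<in>edges H. e \<subseteq> verts H)"
proof (induction rule: mw_constructible.induct)
  case (subst Q G)
  have "verts Q \<noteq> {}" using subst.hyps(2) by auto
  then have "verts (substitution Q G) \<noteq> {}"
    using subst.IH unfolding substitution_def by auto
  moreover have "e \<subseteq> verts (substitution Q G)" if "e \<in> edges (substitution Q G)" for e
  proof -
    have Q: "i \<in> verts Q" "j \<in> verts Q" if "{i, j} \<in> edges Q" for i j
      using subst.hyps(1) that unfolding simple_graph_def by auto
    from that consider i where "i \<in> verts Q" "e \<in> edges (G i)"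
      | x y i j where "e = {x, y}" "{i, j} \<in> edges Q" "x \<in> verts (G i)" "y \<in> verts (G j)"
      unfolding substitution_def by auto
    then show ?thesis
    proof cases
      case 1
      then show ?thesis using subst.IH unfolding substitution_def by auto
    next
      case 2
      then show ?thesis using Q unfolding substitution_def by auto
    qed
  qed
  ultimately show ?case by blast
qed simp

text \<open>Because the parts are disjoint, a vertex determines its part; an edge inside a part
  cannot join two of them, so only an edge of \<open>Q\<close> can.\<close>

lemma edge_substitution_iff:
  assumes "simple_graph Q" "disjoint_family_on (\<lambda>i. verts (G i)) (verts Q)"
    and wf: "\<And>i e. i \<in> verts Q \<Longrightarrow> e \<in> edges (G i) \<Longrightarrow> e \<subseteq> verts (G i)"
    and ij: "i \<in> verts Q" "j \<in> verts Q" "i \<noteq> j" and xy: "x \<in> verts (G i)" "y \<in> verts (G j)"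
  shows "{x, y} \<in> edges (substitution Q G) \<longleftrightarrow> {i, j} \<in> edges Q"
proof
  assume "{i, j} \<in> edges Q"
  then show "{x, y} \<in> edges (substitution Q G)" using xy unfolding substitution_def by auto
next
  have unique: "l = l'" if "l \<in> verts Q" "l' \<in> verts Q" "z \<in> verts (G l)" "z \<in> verts (G l')" for l l' z
    using assms(2) that unfolding disjoint_family_on_def by blast
  assume "{x, y} \<in> edges (substitution Q G)"
  then consider l where "l \<in> verts Q" "{x, y} \<in> edges (G l)"
    | x' y' i' j' where "{x, y} = {x', y'}" "{i', j'} \<in> edges Q" "x' \<in> verts (G i')" "y' \<in> verts (G j')"
    unfolding substitution_def by auto
  then show "{i, j} \<in> edges Q"
  proof cases
    case 1
    then have "x \<in> verts (G l)" "y \<in> verts (G l)" using wf by auto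
    then have "i = l" "j = l" using unique 1 ij xy by blast+
    then show ?thesis using ij by simp
  next
    case 2
    then have "i' \<in> verts Q" "j' \<in> verts Q" using assms(1) unfolding simple_graph_def by auto
    then have "i = i' \<and> j = j' \<or> i = j' \<and> j = i'"
      using 2 unique ij xy by (metis doubleton_eq_iff)
    then show ?thesis using 2(2) by (auto simp: insert_commute)
  qed
qed

text \<open>The parts of the outermost substitution, carried over by the isomorphism. Whether an
  outside vertex is adjacent to a member of a part depends only on an edge of \<open>Q\<close>,
  hence not on the member. With two vertices the single-vertex constructor is excluded.\<close>

lemma ex_modular_partition:
  assumes "simple_graph G" "2 \<le> card (verts G)" "isomorphic H G" "mw_constructible k H"
  shows "\<exists>\<P>. partition_on (verts G) \<P> \<and> 2 \<le> card \<P> \<and> card \<P> \<le> k \<and>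
    (\<forall>P\<in>\<P>. \<forall>x\<in>P. \<forall>y\<in>P. \<forall>w\<in>verts G - P. {x, w} \<in> edges G \<longleftrightarrow> {y, w} \<in> edges G)"
proof -
  obtain \<phi> where \<phi>: "bij_betw \<phi> (verts H) (verts G)" and E: "edges G = (\<lambda>e. \<phi> ` e) ` edges H"
    using assms(3) unfolding isomorphic_def by blast
  have inj: "inj_on \<phi> (verts H)" using \<phi> by (rule bij_betw_imp_inj_on)
  have "card (verts H) = card (verts G)" using \<phi> by (rule bij_betw_same_card)
  from assms(4) show ?thesis
  proof cases
    case (single v)
    then show ?thesis using \<open>card (verts H) = card (verts G)\<close> assms(2) by simp
  next
    case (subst Q F)
    have wf: "verts (F i) \<noteq> {}" "e \<in> edges (F i) \<Longrightarrow> e \<subseteq> verts (F i)" if "i \<in> verts Q" for i e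
      using mw_constructible_wf[OF subst(5)[OF that]] by auto
    have VH: "verts H = (\<Union>i\<in>verts Q. verts (F i))" using subst by (simp add: substitution_def)
    define P where "P i = \<phi> ` verts (F i)" for i
    have disj: "P i \<inter> P j = {}" if "i \<in> verts Q" "j \<in> verts Q" "i \<noteq> j" for i j
    proof -
      have "\<phi> ` (verts (F i) \<inter> verts (F j)) = P i \<inter> P j"
        unfolding P_def by (rule inj_on_image_Int[OF inj]) (use that VH in auto)
      moreover have "verts (F i) \<inter> verts (F j) = {}"
        using subst(6) that unfolding disjoint_family_on_def by blast
      ultimately show ?thesis by simp
    qed
    have ne: "P i \<noteq> {}" if "i \<in> verts Q" for i using wf(1)[OF that] by (simp add: P_def)
    have inj_P: "inj_on P (verts Q)"
      by (rule inj_onI) (use disj ne in fastforce)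
    have Un: "(\<Union>i\<in>verts Q. P i) = verts G"
      using bij_betw_imp_surj_on[OF \<phi>] unfolding P_def VH image_UN .
    have partition: "partition_on (verts G) (P ` verts Q)"
    proof (rule partition_onI)
      fix p q assume pq: "p \<in> P ` verts Q" "q \<in> P ` verts Q" "p \<noteq> q"
      then obtain i j where "i \<in> verts Q" "j \<in> verts Q" "p = P i" "q = P j" by blast
      moreover have "i \<noteq> j" using calculation pq(3) by blast
      ultimately show "disjnt p q" unfolding disjnt_def using disj by simp
    qed (use Un ne in auto)
    have card: "card (P ` verts Q) = card (verts Q)" using inj_P by (rule card_image)
    have "{x, w} \<in> edges G \<longleftrightarrow> {y, w} \<in> edges G"
      if i: "i \<in> verts Q" and xy: "x \<in> P i" "y \<in> P i" and w: "w \<in> verts G - P i" for i x y w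
    proof -
      obtain j where j: "j \<in> verts Q" "w \<in> P j" using Un w by blast
      have "i \<noteq> j" using j w by blast
      have "{z, w} \<in> edges G \<longleftrightarrow> {i, j} \<in> edges Q" if z: "z \<in> P i" for z
      proof -
        obtain z' w' where z': "z = \<phi> z'" "z' \<in> verts (F i)" "w = \<phi> w'" "w' \<in> verts (F j)"
          using z j unfolding P_def by blast
        have sub: "{z', w'} \<subseteq> verts H" using z' j(1) \<open>i \<in> verts Q\<close> VH by auto
        have "{z, w} \<in> edges G \<longleftrightarrow> \<phi> ` {z', w'} \<in> (\<lambda>e. \<phi> ` e) ` edges H" unfolding E z' by simp
        also have "\<dots> \<longleftrightarrow> {z', w'} \<in> edges H"
        proof (rule inj_on_image_mem_iff[OF inj_on_image_Pow[OF inj]])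
          show "{z', w'} \<in> Pow (verts H)" using sub by simp
          show "edges H \<subseteq> Pow (verts H)" using mw_constructible_wf[OF assms(4)] by blast
        qed
        also have "\<dots> \<longleftrightarrow> {i, j} \<in> edges Q"
          unfolding subst(1)
          by (rule edge_substitution_iff[OF subst(2,6)])
            (use wf j(1) \<open>i \<in> verts Q\<close> \<open>i \<noteq> j\<close> z' in auto)
        finally show ?thesis .
      qed
      then show ?thesis using xy by simp
    qed
    then have "\<forall>p\<in>P ` verts Q. \<forall>x\<in>p. \<forall>y\<in>p. \<forall>w\<in>verts G - p.
        {x, w} \<in> edges G \<longleftrightarrow> {y, w} \<in> edges G"
      by blast
    moreover have "2 \<le> card (P ` verts Q)" "card (P ` verts Q) \<le> k" using card subst(3,4) by simp_all
    ultimately show ?thesis using partition by blast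
  qed
qed

text \<open>Substituting single vertices into \<open>G\<close> rebuilds \<open>G\<close>. Hence the
  \<open>LEAST\<close> in \<open>modular_width\<close> ranges over a nonempty set and its value is
  attained.\<close>

lemma mw_constructible_card:
  fixes G :: "nat graph"
  assumes "simple_graph G"
  shows "mw_constructible (card (verts G)) G"
proof (cases "card (verts G) = 1")
  case True
  then obtain v where v: "verts G = {v}" by (auto simp: card_1_singleton_iff)
  have "edges G = {}"
  proof (rule ccontr)
    assume "edges G \<noteq> {}"
    then obtain e where "e \<subseteq> {v}" "card e = 2" using assms v unfolding simple_graph_def by auto
    then show False using card_mono[of "{v}" e] by simp
  qed
  then have "G = ({v}, {})" using v by (simp add: prod_eq_iff)
  then show ?thesis using mw_constructible.single by metis
next
  case False
  moreover have "card (verts G) \<noteq> 0" using assms unfolding simple_graph_def by simp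
  ultimately have "2 \<le> card (verts G)" by simp
  then have "mw_constructible (card (verts G)) (substitution G (\<lambda>i. ({i}, {})))"
    by (intro mw_constructible.subst mw_constructible.single assms) (auto simp: disjoint_family_on_def)
  moreover have "edges G = {{x, y} |x y. {x, y} \<in> edges G}"
    using assms unfolding simple_graph_def by (auto simp: card_2_iff) (metis)
  then have "substitution G (\<lambda>i. ({i}, {})) = G"
    by (auto simp: substitution_def prod_eq_iff)
  ultimately show ?thesis by simp
qed

lemma
  fixes G :: "nat graph"
  assumes "simple_graph G"
  shows modular_width_le_card: "modular_width G \<le> card (verts G)"
    and modular_width_pos: "0 < modular_width G"
    and modular_width_attained: "\<exists>H :: nat graph. isomorphic H G \<and> mw_constructible (modular_width G) H"
proof -
  let ?P = "\<lambda>k. 0 < k \<and> (\<exists>H :: nat graph. isomorphic H G \<and> mw_constructible k H)"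
  have "isomorphic G G" unfolding isomorphic_def by (rule exI[of _ id]) simp
  then have P: "?P (card (verts G))"
    using mw_constructible_card[OF assms] assms unfolding simple_graph_def card_gt_0_iff by blast
  then show "modular_width G \<le> card (verts G)" unfolding modular_width_def by (rule Least_le)
  from LeastI[of ?P, OF P] show "0 < modular_width G"
    "\<exists>H :: nat graph. isomorphic H G \<and> mw_constructible (modular_width G) H"
    unfolding modular_width_def by blast+
qed

section \<open>Cuts given by one side, and edges that no matching cut contains\<close>

definition cut :: "'v set set \<Rightarrow> 'v set \<Rightarrow> 'v set set" where
  "cut E A = {e \<in> E. \<exists>x\<in>A. \<exists>y. y \<notin> A \<and> e = {x, y}}"

lemma mem_cut_iff: "{u, v} \<in> cut E A \<longleftrightarrow> {u, v} \<in> E \<and> (u \<in> A) \<noteq> (v \<in> A)"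
  unfolding cut_def by (auto simp: doubleton_eq_iff insert_commute)

lemma cutE:
  assumes "e \<in> cut E A"
  obtains x y where "e = {x, y}" "x \<in> A" "y \<notin> A" "{x, y} \<in> E"
  using assms unfolding cut_def by blast

text \<open>A bipartition is determined by one side. In \<open>cut\<close> the other side is the
  complement in the whole type; this changes nothing, since the ends of edges are vertices.\<close>

lemma matching_cut_iff:
  assumes "simple_graph G"
  shows "matching_cut G M \<longleftrightarrow>
    matching M \<and> (\<exists>A. A \<subseteq> verts G \<and> A \<noteq> {} \<and> A \<noteq> verts G \<and> M = cut (edges G) A)"
proof -
  have part: "partition_on V {A, B} \<and> A \<noteq> B \<longleftrightarrow> A \<subseteq> V \<and> A \<noteq> {} \<and> A \<noteq> V \<and> B = V - A" for V A B :: "'a set"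
  proof -
    have "partition_on V {A, B} \<and> A \<noteq> B \<longleftrightarrow> A \<union> B = V \<and> A \<inter> B = {} \<and> A \<noteq> {} \<and> B \<noteq> {}"
      unfolding partition_on_def disjoint_def by auto
    then show ?thesis by blast
  qed
  have eq: "edges_between G A (verts G - A) = cut (edges G) A" for A
  proof -
    have "y \<in> verts G" if "{x, y} \<in> edges G" for x y
      using assms that unfolding simple_graph_def by auto
    then have "(\<exists>y\<in>verts G - A. e = {x, y}) \<longleftrightarrow> (\<exists>y. y \<notin> A \<and> e = {x, y})" if "e \<in> edges G" for e x
      using that by auto
    then show ?thesis unfolding edges_between_def cut_def by (simp cong: conj_cong)
  qed
  have "(\<exists>B. partition_on (verts G) {A, B} \<and> A \<noteq> B \<and> M = edges_between G A B) \<longleftrightarrow>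
      A \<subseteq> verts G \<and> A \<noteq> {} \<and> A \<noteq> verts G \<and> M = cut (edges G) A"
    (is "?l A \<longleftrightarrow> ?r A") for A
  proof
    assume "?l A"
    then obtain B where "partition_on (verts G) {A, B} \<and> A \<noteq> B" "M = edges_between G A B" by blast
    then show "?r A" unfolding part by (simp add: eq)
  next
    assume "?r A"
    then have "partition_on (verts G) {A, verts G - A} \<and> A \<noteq> verts G - A" unfolding part by simp
    with \<open>?r A\<close> show "?l A" by (intro exI[of _ "verts G - A"]) (simp add: eq)
  qed
  then show ?thesis unfolding matching_cut_def by (simp only:)
qed

lemma matchingD: "matching M \<Longrightarrow> e \<in> M \<Longrightarrow> e' \<in> M \<Longrightarrow> x \<in> e \<Longrightarrow> x \<in> e' \<Longrightarrow> e = e'"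
  unfolding matching_def by blast

lemma matching_cutD:
  assumes "matching (cut E A)" "{u, v} \<in> E" "{u, w} \<in> E" "(u \<in> A) \<noteq> (v \<in> A)" "(u \<in> A) \<noteq> (w \<in> A)"
  shows "v = w"
proof -
  have cut: "{u, v} \<in> cut E A" "{u, w} \<in> cut E A" using assms(2-) unfolding mem_cut_iff by blast+
  have "{u, v} = {u, w}" by (rule matchingD[OF assms(1) cut, of u]) simp_all
  then show ?thesis unfolding doubleton_eq_iff by metis
qed

text \<open>If \<open>a\<close> and \<open>x\<close> were separated, \<open>y\<close> would be
  separated from one of them, and two cut edges would meet in that vertex.\<close>

lemma triangle_same_side:
  assumes "matching (cut E A)" "{a, x} \<in> E" "{a, y} \<in> E" "{x, y} \<in> E" "a \<noteq> y" "x \<noteq> y"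
  shows "a \<in> A \<longleftrightarrow> x \<in> A"
proof -
  have "{x, a} \<in> E" using assms(2) by (simp add: insert_commute)
  then show ?thesis
    using assms(2-) matching_cutD[OF assms(1), of a x y] matching_cutD[OF assms(1), of x a y] by argo
qed

text \<open>If \<open>x\<close> is separated from \<open>a\<close>, then \<open>y\<close> and
  \<open>z\<close> stay with \<open>a\<close>. Now \<open>b\<close> on the side of \<open>a\<close>
  gives two cut edges at \<open>x\<close>, and \<open>b\<close> on the other side gives two cut
  edges at \<open>b\<close>.\<close>

lemma K23_same_side:
  assumes "matching (cut E A)" "a \<noteq> b" "x \<noteq> y" "x \<noteq> z" "y \<noteq> z"
    "{a, x} \<in> E" "{a, y} \<in> E" "{a, z} \<in> E" "{b, x} \<in> E" "{b, y} \<in> E" "{b, z} \<in> E"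
  shows "a \<in> A \<longleftrightarrow> x \<in> A"
proof -
  have "{x, a} \<in> E" "{x, b} \<in> E" using assms(6,9) by (simp_all add: insert_commute)
  then show ?thesis
    using assms(2-) matching_cutD[OF assms(1), of a x y] matching_cutD[OF assms(1), of a x z]
    matching_cutD[OF assms(1), of a y z] matching_cutD[OF assms(1), of b x y]
    matching_cutD[OF assms(1), of b x z] matching_cutD[OF assms(1), of b y z]
    matching_cutD[OF assms(1), of x a b]
    by argo
qed

lemma matching_image_iff:
  assumes "inj_on f A" "N \<subseteq> Pow A"
  shows "matching ((`) f ` N) \<longleftrightarrow> matching N"
proof -
  have "f ` e \<inter> f ` e' = {} \<longleftrightarrow> e \<inter> e' = {}" if "e \<in> N" "e' \<in> N" for e e'
    using inj_on_image_Int[OF assms(1), of e e'] that assms(2) by (metis PowD image_is_empty subsetD)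
  moreover have "f ` e = f ` e' \<longleftrightarrow> e = e'" if "e \<in> N" "e' \<in> N" for e e'
    using inj_on_image_eq_iff[OF assms(1)] that assms(2) by (metis PowD subsetD)
  ultimately show ?thesis unfolding matching_def by simp
qed

section \<open>Definition of the kernel and of the lifted cuts\<close>

definition strong :: "nat \<Rightarrow> (nat \<Rightarrow> nat \<Rightarrow> bool) \<Rightarrow> nat \<Rightarrow> nat \<Rightarrow> bool" where
  "strong n r a x \<longleftrightarrow> r a x \<and>
     ((\<exists>y<n. r a y \<and> r x y) \<or>
      (\<exists>b<n. b \<noteq> a \<and> r b x \<and>
        (\<exists>y<n. \<exists>z<n. x \<noteq> y \<and> x \<noteq> z \<and> y \<noteq> z \<and> r a y \<and> r b y \<and> r a z \<and> r b z)))"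

text \<open>In \<open>strong\<close> the first vertex lies on the side of size two of the K_{2,3}
  and the second on the side of size three, so the relation has to be symmetrised before its closure
  is an equivalence.\<close>

definition tied :: "nat \<Rightarrow> (nat \<Rightarrow> nat \<Rightarrow> bool) \<Rightarrow> nat \<Rightarrow> nat \<Rightarrow> bool" where
  "tied n r u v \<longleftrightarrow> (u, v) \<in> (restricted n (\<lambda>u v. strong n r u v \<or> strong n r v u))\<^sup>*"

definition conn :: "nat \<Rightarrow> (nat \<Rightarrow> nat \<Rightarrow> bool) \<Rightarrow> bool" where
  "conn n r \<longleftrightarrow> (\<forall>v<n. (0, v) \<in> (restricted n r)\<^sup>*)"

text \<open>Excluding vertex 0 ensures that two pendant vertices of a connected graph are never adjacent,
  not even in \<open>K\<^sub>2\<close>.\<close>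

definition pendant :: "nat \<Rightarrow> (nat \<Rightarrow> nat \<Rightarrow> bool) \<Rightarrow> nat \<Rightarrow> bool" where
  "pendant n r p \<longleftrightarrow> p \<noteq> 0 \<and> p < n \<and> (\<exists>v<n. r p v \<and> (\<forall>w<n. r p w \<longrightarrow> w = v))"

definition first_pendant :: "nat \<Rightarrow> (nat \<Rightarrow> nat \<Rightarrow> bool) \<Rightarrow> nat \<Rightarrow> bool" where
  "first_pendant n r p \<longleftrightarrow> pendant n r p \<and> (\<forall>q<p. \<not> pendant n r q)"

text \<open>Vertex 0 is kept so that the kernel is never empty.\<close>

definition kept :: "nat \<Rightarrow> (nat \<Rightarrow> nat \<Rightarrow> bool) \<Rightarrow> nat \<Rightarrow> bool" where
  "kept n r v \<longleftrightarrow> v = 0 \<or>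
     (\<exists>w<n. r v w \<and> \<not> tied n r v w) \<and> (pendant n r v \<longrightarrow> first_pendant n r v)"

definition kept_list :: "nat \<Rightarrow> (nat \<Rightarrow> nat \<Rightarrow> bool) \<Rightarrow> nat list" where
  "kept_list n r = filter (kept n r) [0..<n]"

text \<open>The default 0 is what reading beyond the end of an encoded list yields:
  \<open>nth_tree\<close> returns \<open>Leaf\<close> there, and \<open>nat_of\<close> turns it into
  0.\<close>

definition nth0 :: "nat list \<Rightarrow> nat \<Rightarrow> nat" where
  "nth0 xs i = (if i < length xs then xs ! i else 0)"

definition origin :: "nat \<Rightarrow> (nat \<Rightarrow> nat \<Rightarrow> bool) \<Rightarrow> nat \<Rightarrow> nat" where
  "origin n r = nth0 (kept_list n r @ kept_list n r @ kept_list n r)"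

text \<open>All copies of the members of a class form a clique, but original edges are drawn only
  between first copies: the copies stabilise the classes without multiplying the edges that a cut
  may contain.\<close>

definition kernel_adj :: "nat \<Rightarrow> (nat \<Rightarrow> nat \<Rightarrow> bool) \<Rightarrow> nat \<Rightarrow> nat \<Rightarrow> bool" where
  "kernel_adj n r i j \<longleftrightarrow> i \<noteq> j \<and> (tied n r (origin n r i) (origin n r j) \<or>
     i < length (kept_list n r) \<and> j < length (kept_list n r) \<and> r (origin n r i) (origin n r j))"

definition kernel_edges :: "nat \<Rightarrow> (nat \<Rightarrow> nat \<Rightarrow> bool) \<Rightarrow> nat set set" where
  "kernel_edges n r = {{i, j} |i j. i < 3 * length (kept_list n r) \<and> j < 3 * length (kept_list n r) \<and>
     kernel_adj n r i j}"

definition pull_back :: "nat \<Rightarrow> (nat \<Rightarrow> nat \<Rightarrow> bool) \<Rightarrow> nat set set \<Rightarrow> nat set set" where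
  "pull_back n r N = {{origin n r i, origin n r j} |i j.
     i < length (kept_list n r) \<and> j < length (kept_list n r) \<and> {i, j} \<in> N}"

definition star :: "(nat \<Rightarrow> nat \<Rightarrow> bool) \<Rightarrow> nat \<Rightarrow> nat set set" where
  "star r p = {{u, v} |u v. r u v \<and> (u = p \<or> v = p)}"

text \<open>The test asks whether \<open>N\<close> uses the edge at the representative pendant
  vertex. A minimal cut that does consists of this edge alone, and it answers for the edges at all
  pendant vertices.\<close>

definition lift_cuts :: "nat \<Rightarrow> (nat \<Rightarrow> nat \<Rightarrow> bool) \<Rightarrow> nat set set \<Rightarrow> nat set set list" where
  "lift_cuts n r N =
     (if \<exists>i<length (kept_list n r). \<exists>j<length (kept_list n r). {i, j} \<in> N \<and> first_pendant n r (origin n r i)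
      then map (star r) (filter (pendant n r) [0..<n]) else [pull_back n r N])"

section \<open>Classes and pendant vertices of a connected graph\<close>

locale connected_graph =
  fixes n :: nat and E :: "nat set set" and r :: "nat \<Rightarrow> nat \<Rightarrow> bool"
  defines "r \<equiv> \<lambda>u v. {u, v} \<in> E"
  assumes n_pos: "0 < n" and edge: "\<And>e. e \<in> E \<Longrightarrow> e \<subseteq> {..<n} \<and> card e = 2"
    and connected: "conn n r"
begin

lemma edgeD: "{u, v} \<in> E \<Longrightarrow> u < n \<and> v < n \<and> u \<noteq> v"
  using edge[of "{u, v}"] by auto

lemma simple: "simple_graph ({..<n}, E)"
  using n_pos edge unfolding simple_graph_def by auto

text \<open>The form in which connectedness is used: from \<open>u\<close> the closed set reaches
  vertex 0, adjacency being symmetric, and from there every vertex.\<close>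

lemma closed_eq_all:
  assumes "u \<in> A" "A \<subseteq> {..<n}" "\<And>u v. u \<in> A \<Longrightarrow> {u, v} \<in> E \<Longrightarrow> v \<in> A"
  shows "A = {..<n}"
proof -
  have sym: "sym (restricted n r)" by (auto simp: sym_def restricted_def r_def insert_commute)
  have step: "v \<in> A" if "(u, v) \<in> (restricted n r)\<^sup>*" "u \<in> A" for u v
    using that by (induction rule: rtrancl_induct) (use assms(3) in \<open>auto simp: restricted_def r_def\<close>)
  have "(u, 0) \<in> (restricted n r)\<^sup>*"
    using connected assms(1,2) sym_rtrancl[OF sym] unfolding conn_def by (auto dest: symD)
  then have "0 \<in> A" using step assms(1) by blast
  then show ?thesis using step connected assms(2) unfolding conn_def by auto
qed

lemma tied_refl [simp]: "tied n r u u"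
  by (simp add: tied_def)

lemma tied_sym: "tied n r u v \<Longrightarrow> tied n r v u"
  unfolding tied_def by (rule symD[OF sym_rtrancl]) (auto simp: sym_def restricted_def)

lemma tied_trans: "tied n r u v \<Longrightarrow> tied n r v w \<Longrightarrow> tied n r u w"
  unfolding tied_def by (rule rtrancl_trans)

lemma strong_tied:
  assumes "strong n r u v" shows "tied n r u v"
proof -
  have "r u v" using assms unfolding strong_def by blast
  then have "u < n" "v < n" using edgeD unfolding r_def by auto
  with assms show ?thesis unfolding tied_def by (intro r_into_rtrancl) (simp add: restricted_def)
qed

lemma strong_same_side:
  assumes "matching (cut E A)" "strong n r a x"
  shows "a \<in> A \<longleftrightarrow> x \<in> A"
proof -
  from assms(2) consider y where "{a, x} \<in> E" "{a, y} \<in> E" "{x, y} \<in> E"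
    | b y z where "{a, x} \<in> E" "b \<noteq> a" "{b, x} \<in> E" "x \<noteq> y" "x \<noteq> z" "y \<noteq> z"
      "{a, y} \<in> E" "{b, y} \<in> E" "{a, z} \<in> E" "{b, z} \<in> E"
    unfolding strong_def r_def by blast
  then show ?thesis
  proof cases
    case 1
    moreover have "a \<noteq> y" "x \<noteq> y" using edgeD[OF 1(2)] edgeD[OF 1(3)] by simp_all
    ultimately show ?thesis by (rule triangle_same_side[OF assms(1)])
  next
    case 2
    then show ?thesis using not_sym[OF 2(2)] by (intro K23_same_side[OF assms(1), of a b x y z]) assumption+
  qed
qed

lemma tied_same_side:
  assumes "matching (cut E A)" "tied n r u v"
  shows "u \<in> A \<longleftrightarrow> v \<in> A"
  using assms(2) unfolding tied_def
  by (induction rule: rtrancl_induct) (use strong_same_side[OF assms(1)] in \<open>auto simp: restricted_def\<close>)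

lemma pendantE:
  assumes "pendant n r p"
  obtains v where "p \<noteq> 0" "p < n" "v < n" "v \<noteq> p" "\<forall>w. {p, w} \<in> E \<longleftrightarrow> w = v"
proof -
  obtain v where v: "p \<noteq> 0" "p < n" "v < n" "{p, v} \<in> E" "\<forall>w<n. {p, w} \<in> E \<longrightarrow> w = v"
    using assms unfolding pendant_def r_def by blast
  show ?thesis by (rule that[of v]) (use v edgeD in blast)+
qed

text \<open>In a triangle and in a K_{2,3} every vertex has degree at least two.\<close>

lemma pendant_not_strong:
  assumes "pendant n r p" shows "\<not> strong n r p x" "\<not> strong n r x p"
proof -
  obtain v where v: "p \<noteq> 0" "p < n" "v < n" "v \<noteq> p" "\<forall>w. {p, w} \<in> E \<longleftrightarrow> w = v"
    using assms by (rule pendantE)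
  have v': "{w, p} \<in> E \<longleftrightarrow> w = v" for w using v(5) by (metis insert_commute)
  have irr: "{u, u} \<notin> E" for u using edgeD by blast
  show "\<not> strong n r p x" "\<not> strong n r x p"
    unfolding strong_def r_def using v(5) v' irr by auto
qed

lemma pendant_tied:
  assumes "pendant n r p" "tied n r p w" shows "w = p"
  using assms(2) pendant_not_strong[OF assms(1)] unfolding tied_def
  by (auto elim: converse_rtranclE simp: restricted_def)

text \<open>Two adjacent vertices of degree one form a component, here the whole graph, which would
  contain vertex 0.\<close>

lemma pendants_not_adjacent:
  assumes "pendant n r p" "pendant n r q" shows "{p, q} \<notin> E"
proof
  assume pq: "{p, q} \<in> E"
  then have qp: "{q, p} \<in> E" by (simp add: insert_commute)
  obtain v where v: "p \<noteq> 0" "p < n" "\<forall>w. {p, w} \<in> E \<longleftrightarrow> w = v" using assms(1) by (rule pendantE) blast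
  obtain w where w: "q \<noteq> 0" "q < n" "\<forall>u. {q, u} \<in> E \<longleftrightarrow> u = w" using assms(2) by (rule pendantE) blast
  have "{p, q} = {..<n}"
  proof (rule closed_eq_all[of p])
    show "{p, q} \<subseteq> {..<n}" using v(2) w(2) by simp
    show "y \<in> {p, q}" if "x \<in> {p, q}" "{x, y} \<in> E" for x y
    proof -
      have "q = v" "p = w" using v(3) w(3) pq qp by blast+
      from that(1) consider "x = p" | "x = q" by blast
      then show ?thesis
      proof cases
        case 1
        then show ?thesis using that(2) v(3) \<open>q = v\<close> by simp
      next
        case 2
        then show ?thesis using that(2) w(3) \<open>p = w\<close> by simp
      qed
    qed
  qed simp
  moreover have "0 \<in> {..<n}" using n_pos by simp
  ultimately have "0 \<in> {p, q}" by (simp only:)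
  then show False using v(1) w(1) by blast
qed

lemma first_pendant_unique: "first_pendant n r p \<Longrightarrow> first_pendant n r q \<Longrightarrow> p = q"
  unfolding first_pendant_def by (cases p q rule: linorder_cases) blast+

lemma first_pendant_exists: "pendant n r p \<Longrightarrow> \<exists>q. first_pendant n r q"
  unfolding first_pendant_def
  by (intro exI[of _ "LEAST q. pendant n r q"] conjI allI impI) (rule LeastI, assumption, rule not_less_Least)

section \<open>Kept vertices and their three copies\<close>

lemma set_kept_list: "set (kept_list n r) = {v. v < n \<and> kept n r v}"
  unfolding kept_list_def by auto

lemma distinct_kept_list: "distinct (kept_list n r)"
  unfolding kept_list_def by simp

lemma zero_kept: "0 \<in> set (kept_list n r)"
  using n_pos unfolding set_kept_list kept_def by simp

lemma kept_list_pos: "0 < length (kept_list n r)"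
  using zero_kept by (cases "kept_list n r") auto

lemma origin_copies:
  assumes "i < length (kept_list n r)"
  shows "origin n r i = kept_list n r ! i" "origin n r (length (kept_list n r) + i) = kept_list n r ! i"
    "origin n r (2 * length (kept_list n r) + i) = kept_list n r ! i"
  using assms unfolding origin_def nth0_def by (simp_all add: nth_append)

lemma copies_cases:
  assumes "i < 3 * length (kept_list n r)"
  obtains k where "k < length (kept_list n r)"
    "i = k \<or> i = length (kept_list n r) + k \<or> i = 2 * length (kept_list n r) + k"
proof -
  let ?m = "length (kept_list n r)"
  consider "i < ?m" | "?m \<le> i" "i < 2 * ?m" | "2 * ?m \<le> i" by linarith
  then show ?thesis
  proof cases
    case 1
    then show ?thesis by (intro that[of i]) simp_all
  next
    case 2
    then show ?thesis by (intro that[of "i - ?m"]) simp_all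
  next
    case 3
    then show ?thesis using assms by (intro that[of "i - 2 * ?m"]) simp_all
  qed
qed

text \<open>Supplies the companions with which every class of the kernel contains triangles, even if
  only one of its vertices is kept.\<close>

lemma two_more_copies:
  assumes "i < 3 * length (kept_list n r)"
  obtains j k where "j < 3 * length (kept_list n r)" "k < 3 * length (kept_list n r)"
    "i \<noteq> j" "i \<noteq> k" "j \<noteq> k" "origin n r j = origin n r i" "origin n r k = origin n r i"
proof -
  let ?m = "length (kept_list n r)"
  note pos = kept_list_pos
  obtain k where k: "k < ?m" "i = k \<or> i = ?m + k \<or> i = 2 * ?m + k"
    using assms by (rule copies_cases)
  from k(2) show ?thesis
  proof (elim disjE)
    assume "i = k"
    then show ?thesis using k(1) by (intro that[of "?m + k" "2 * ?m + k"]) (use pos in \<open>simp_all add: origin_copies\<close>)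
  next
    assume "i = ?m + k"
    then show ?thesis using k(1) by (intro that[of k "2 * ?m + k"]) (use pos in \<open>simp_all add: origin_copies\<close>)
  next
    assume "i = 2 * ?m + k"
    then show ?thesis using k(1) by (intro that[of k "?m + k"]) (use pos in \<open>simp_all add: origin_copies\<close>)
  qed
qed

lemma origin_kept:
  assumes "i < 3 * length (kept_list n r)" shows "origin n r i \<in> set (kept_list n r)"
proof -
  obtain k where "k < length (kept_list n r)"
    "i = k \<or> i = length (kept_list n r) + k \<or> i = 2 * length (kept_list n r) + k"
    using assms by (rule copies_cases)
  then show ?thesis by (elim disjE) (simp_all add: origin_copies)
qed

lemma inj_on_origin: "inj_on (origin n r) {..<length (kept_list n r)}"
  using distinct_kept_list by (intro inj_onI) (simp add: origin_copies nth_eq_iff_index_eq)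

lemma origin_onto:
  assumes "v < n" "kept n r v"
  obtains i where "i < length (kept_list n r)" "origin n r i = v"
proof -
  have "v \<in> set (kept_list n r)" using assms unfolding set_kept_list by simp
  then obtain i where "i < length (kept_list n r)" "kept_list n r ! i = v" unfolding in_set_conv_nth by blast
  then show ?thesis by (intro that[of i]) (simp_all add: origin_copies)
qed

section \<open>The number of kept vertices\<close>

text \<open>A module with at least three vertices is tied to its whole neighbourhood, unless it hangs
  on a single vertex; in the latter case its vertices are pendant or tied to that vertex.\<close>

lemma kept_in_module:
  assumes P: "P \<subseteq> {..<n}" "P \<noteq> {..<n}" "3 \<le> card P"
    and module: "\<forall>x\<in>P. \<forall>y\<in>P. \<forall>w\<in>{..<n} - P. {x, w} \<in> E \<longleftrightarrow> {y, w} \<in> E"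
    and v: "v \<in> P" "kept n r v" "v \<noteq> 0"
  shows "first_pendant n r v"
proof -
  obtain u where u: "u < n" "{v, u} \<in> E" "\<not> tied n r v u" and first: "pendant n r v \<longrightarrow> first_pendant n r v"
    using v unfolding kept_def r_def by blast
  have "v < n" using v(1) P(1) by blast
  have outside: "{x, w} \<in> E" if "x \<in> P" "y \<in> P" "{y, w} \<in> E" "w \<notin> P" for x y w
  proof -
    have "w \<in> {..<n} - P" using that(4) edgeD[OF that(3)] by simp
    then show ?thesis using module that(1,2,3) by blast
  qed
  \<comment> \<open>By connectedness some edge leaves \<open>P\<close>; since \<open>P\<close> is a
    module, its outer end is adjacent to \<open>v\<close> as well.\<close>
  obtain w where w: "w \<notin> P" "{v, w} \<in> E"
  proof -
    have "\<exists>x y. x \<in> P \<and> {x, y} \<in> E \<and> y \<notin> P" using closed_eq_all[OF v(1) P(1)] P(2) by blast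
    then show ?thesis using that outside[OF v(1)] by blast
  qed
  \<comment> \<open>The outer neighbour \<open>w\<close> completes a triangle on the edge from
    \<open>v\<close> to \<open>x\<close>.\<close>
  have inside: "tied n r v x" if "x \<in> P" "{v, x} \<in> E" for x
  proof (rule strong_tied)
    have "{x, w} \<in> E" using outside[OF that(1) v(1) w(2,1)] .
    moreover have "w < n" using edgeD[OF w(2)] by simp
    ultimately show "strong n r v x" unfolding strong_def r_def using that(2) w(2) by blast
  qed
  then have "u \<notin> P" using u by blast
  obtain y z where yz: "y \<in> P" "z \<in> P" "v \<noteq> y" "v \<noteq> z" "y \<noteq> z"
  proof -
    have "finite P" using P(1) finite_subset by blast
    then have "card (P - {v}) = card P - 1" using v(1) by simp
    then have "\<not> card (P - {v}) \<le> Suc 0" using P(3) by simp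
    then show ?thesis using that \<open>finite P\<close> by (subst (asm) card_le_Suc0_iff_eq) auto
  qed
  \<comment> \<open>A second outside neighbour would give a K_{2,3} with sides \<open>u, b\<close>
    and \<open>v, y, z\<close>, so \<open>u\<close> and \<open>v\<close> would be tied. This is
    where the third vertex of the part is needed.\<close>
  have "b = u" if b: "b \<notin> P" "{v, b} \<in> E" for b
  proof (rule ccontr)
    assume "b \<noteq> u"
    have out: "r c x" if "c \<notin> P" "{v, c} \<in> E" "x \<in> P" for c x
      using outside[OF that(3) v(1) that(2,1)] by (simp add: r_def insert_commute)
    have "b < n" using edgeD[OF b(2)] by simp
    moreover have "y < n" "z < n" using yz P(1) by auto
    ultimately have "strong n r u v"
      unfolding strong_def using \<open>b \<noteq> u\<close> yz(3-5) out[OF \<open>u \<notin> P\<close> u(2)] out[OF b] v(1) yz(1,2) by blast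
    then show False using strong_tied tied_sym u(3) by blast
  qed
  then have "w = u" using w by blast
  \<comment> \<open>A neighbour of \<open>v\<close> within \<open>P\<close> is also adjacent to
    \<open>u\<close>, and the triangle would tie \<open>v\<close> to \<open>u\<close>.\<close>
  have "x = u" if "{v, x} \<in> E" for x
  proof (cases "x \<in> P")
    case True
    have "{u, x} \<in> E"
      using outside[OF True v(1) u(2) \<open>u \<notin> P\<close>] by (simp add: insert_commute)
    moreover have "x < n" using edgeD[OF that] by simp
    ultimately have "strong n r v u" unfolding strong_def r_def using that u(2) by blast
    then show ?thesis using strong_tied u(3) by blast
  next
    case False
    then show ?thesis using that \<open>\<And>b. b \<notin> P \<Longrightarrow> {v, b} \<in> E \<Longrightarrow> b = u\<close> by blast
  qed
  then have "pendant n r v" unfolding pendant_def r_def using u v(3) \<open>v < n\<close> by blast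
  then show ?thesis using first by blast
qed

text \<open>It suffices that each part keeps at most two vertices. This is clear for parts of size
  at most two; a larger part keeps at most vertex 0 and the first pendant vertex, which is unique.
  The one-vertex graph has no partition into two parts and is treated directly.\<close>

lemma length_kept_list_le: "length (kept_list n r) \<le> 2 * modular_width ({..<n}, E)"
proof (cases "n = 1")
  case True
  then have "length (kept_list n r) \<le> 1" unfolding kept_list_def by simp
  then show ?thesis using modular_width_pos[OF simple] by linarith
next
  case False
  let ?K = "set (kept_list n r)"
  obtain H :: "nat graph" where H: "isomorphic H ({..<n}, E)" "mw_constructible (modular_width ({..<n}, E)) H"
    using modular_width_attained[OF simple] by blast
  have "2 \<le> card (verts ({..<n}, E))" using False n_pos by simp
  from ex_modular_partition[OF simple this H] obtain \<P> where
    part: "partition_on {..<n} \<P>" and card: "2 \<le> card \<P>" "card \<P> \<le> modular_width ({..<n}, E)"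
    and module: "\<forall>P\<in>\<P>. \<forall>x\<in>P. \<forall>y\<in>P. \<forall>w\<in>{..<n} - P. {x, w} \<in> E \<longleftrightarrow> {y, w} \<in> E"
    unfolding fst_conv snd_conv by blast
  have "finite \<P>" using card(1) by (metis card.infinite not_numeral_le_zero)
  have two: "card (?K \<inter> P) \<le> 2" if "P \<in> \<P>" for P
  proof -
    have P: "P \<subseteq> {..<n}" using part that unfolding partition_on_def by blast
    then have "finite P" by (rule finite_subset) simp
    show ?thesis
    proof (cases "3 \<le> card P")
      case False
      then show ?thesis using card_mono[OF \<open>finite P\<close>, of "?K \<inter> P"] by simp
    next
      case True
      have "P \<noteq> {..<n}"
      proof
        assume "P = {..<n}"
        have "\<P> \<subseteq> {P}"
        proof
          fix P' assume "P' \<in> \<P>"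
          then have "P' \<noteq> {}" "P' \<subseteq> P" using part \<open>P = {..<n}\<close> unfolding partition_on_def by auto
          then show "P' \<in> {P}" using part that \<open>P' \<in> \<P>\<close> unfolding partition_on_def disjoint_def by blast
        qed
        then have "card \<P> \<le> 1" using card_mono[of "{P}" \<P>] by simp
        then show False using card(1) by simp
      qed
      have fp: "first_pendant n r v" if "v \<in> ?K \<inter> P" "v \<noteq> 0" for v
        using kept_in_module[OF P \<open>P \<noteq> {..<n}\<close> True _ _ _ that(2)] module \<open>P \<in> \<P>\<close> that(1)
        unfolding set_kept_list by blast
      obtain q where "?K \<inter> P \<subseteq> {0, q}"
      proof (cases "\<exists>q. first_pendant n r q")
        case True
        then obtain q where "first_pendant n r q" by blast
        then have "?K \<inter> P \<subseteq> {0, q}" using fp first_pendant_unique by blast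
        then show ?thesis by (rule that)
      next
        case False
        then have "?K \<inter> P \<subseteq> {0, 0}" using fp by blast
        then show ?thesis by (rule that)
      qed
      then have "card (?K \<inter> P) \<le> card {0, q}" by (intro card_mono) simp_all
      also have "\<dots> \<le> 2" by (simp add: card_insert_if)
      finally show ?thesis .
    qed
  qed
  have "?K = (\<Union>P\<in>\<P>. ?K \<inter> P)"
    using partition_onD1[OF part] unfolding set_kept_list by blast
  then have "card ?K \<le> (\<Sum>P\<in>\<P>. card (?K \<inter> P))" using card_UN_le[OF \<open>finite \<P>\<close>] by metis
  also have "\<dots> \<le> (\<Sum>P\<in>\<P>. 2)" by (rule sum_mono) (rule two)
  also have "\<dots> \<le> 2 * modular_width ({..<n}, E)" using card(2) by simp
  finally show ?thesis using distinct_card[OF distinct_kept_list] by simp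
qed

section \<open>Edges and matching cuts of the kernel\<close>

lemma kernel_adj_sym: "kernel_adj n r i j \<longleftrightarrow> kernel_adj n r j i"
proof -
  have "r u v \<longleftrightarrow> r v u" for u v by (simp add: r_def insert_commute)
  then show ?thesis unfolding kernel_adj_def using tied_sym by blast
qed

lemma mem_kernel_edges: "{i, j} \<in> kernel_edges n r \<longleftrightarrow>
    i < 3 * length (kept_list n r) \<and> j < 3 * length (kept_list n r) \<and> kernel_adj n r i j"
proof
  assume "{i, j} \<in> kernel_edges n r"
  then obtain i' j' where "{i, j} = {i', j'}" "i' < 3 * length (kept_list n r)"
    "j' < 3 * length (kept_list n r)" "kernel_adj n r i' j'"
    unfolding kernel_edges_def by blast
  then show "i < 3 * length (kept_list n r) \<and> j < 3 * length (kept_list n r) \<and> kernel_adj n r i j"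
    unfolding doubleton_eq_iff using kernel_adj_sym by blast
qed (auto simp: kernel_edges_def)

lemma simple_kernel: "simple_graph ({..<3 * length (kept_list n r)}, kernel_edges n r)"
proof -
  have "0 \<in> {..<3 * length (kept_list n r)}" using kept_list_pos by simp
  moreover have "e \<subseteq> {..<3 * length (kept_list n r)} \<and> card e = 2" if "e \<in> kernel_edges n r" for e
    using that unfolding kernel_edges_def kernel_adj_def by auto
  ultimately show ?thesis unfolding simple_graph_def fst_conv snd_conv by blast
qed

text \<open>A further copy \<open>k'\<close> of the origin of \<open>i\<close> completes a triangle
  on \<open>i\<close> and \<open>j\<close>. With three copies there is one different from
  \<open>j\<close>, even if \<open>j\<close> is itself a copy of the same vertex.\<close>

lemma kernel_same_side:
  assumes B: "matching (cut (kernel_edges n r) B)"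
    and ij: "i < 3 * length (kept_list n r)" "j < 3 * length (kept_list n r)"
    and tied: "tied n r (origin n r i) (origin n r j)"
  shows "i \<in> B \<longleftrightarrow> j \<in> B"
proof (cases "i = j")
  case False
  obtain k l where kl: "k < 3 * length (kept_list n r)" "l < 3 * length (kept_list n r)"
    "i \<noteq> k" "i \<noteq> l" "k \<noteq> l" "origin n r k = origin n r i" "origin n r l = origin n r i"
    using ij(1) by (rule two_more_copies)
  obtain k' where k': "k' < 3 * length (kept_list n r)" "i \<noteq> k'" "j \<noteq> k'" "origin n r k' = origin n r i"
    by (cases "j = k") (use that[of k] that[of l] kl in blast)+
  show ?thesis
  proof (rule triangle_same_side[OF B])
    show "{i, j} \<in> kernel_edges n r" "{i, k'} \<in> kernel_edges n r" "{j, k'} \<in> kernel_edges n r"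
      unfolding mem_kernel_edges kernel_adj_def using ij k' tied tied_sym False by simp_all
  qed (use k' in simp_all)
qed simp

text \<open>Sets of first copies, on which \<open>origin\<close> is injective: edge sets inside
  \<open>core\<close> can be compared with their images without loss.\<close>

abbreviation core :: "nat set set" where
  "core \<equiv> {{i, j} |i j. i < length (kept_list n r) \<and> j < length (kept_list n r)}"

abbreviation graph :: "nat graph" where
  "graph \<equiv> ({..<n}, E)"

abbreviation kernel :: "nat graph" where
  "kernel \<equiv> ({..<3 * length (kept_list n r)}, kernel_edges n r)"

abbreviation dropped :: "nat \<Rightarrow> bool" where
  "dropped p \<equiv> pendant n r p \<and> \<not> first_pendant n r p"

lemma kept_not_dropped: "kept n r v \<Longrightarrow> \<not> dropped v"
  unfolding kept_def pendant_def by blast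

lemma untied_kept:
  assumes "{u, v} \<in> E" "\<not> tied n r u v" "\<not> dropped u" shows "kept n r u"
  using assms edgeD[OF assms(1)] unfolding kept_def r_def by blast

lemma pull_back_image:
  assumes "N \<subseteq> core" shows "pull_back n r N = (`) (origin n r) ` N"
proof
  show "pull_back n r N \<subseteq> (`) (origin n r) ` N"
  proof
    fix e assume "e \<in> pull_back n r N"
    then obtain i j where "e = {origin n r i, origin n r j}" "{i, j} \<in> N" unfolding pull_back_def by blast
    then show "e \<in> (`) (origin n r) ` N" by (intro image_eqI[of _ _ "{i, j}"]) simp_all
  qed
  show "(`) (origin n r) ` N \<subseteq> pull_back n r N"
  proof
    fix e assume "e \<in> (`) (origin n r) ` N"
    then obtain e' where e': "e' \<in> N" "e = origin n r ` e'" by blast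
    then obtain i j where "e' = {i, j}" "i < length (kept_list n r)" "j < length (kept_list n r)"
      using assms by blast
    then show "e \<in> pull_back n r N" using e' unfolding pull_back_def by auto
  qed
qed

lemma core_subset_Pow: "core \<subseteq> Pow {..<length (kept_list n r)}"
  by auto

lemma matching_pull_back:
  assumes "N \<subseteq> core" shows "matching (pull_back n r N) \<longleftrightarrow> matching N"
  unfolding pull_back_image[OF assms]
  by (rule matching_image_iff[OF inj_on_origin subset_trans[OF assms core_subset_Pow]])

text \<open>Pulling back is an order embedding on edge sets within \<open>core\<close>, so it
  transports minimality and not just the cuts.\<close>

lemma pull_back_subset_iff:
  assumes "N \<subseteq> core" "N' \<subseteq> core" shows "pull_back n r N \<subseteq> pull_back n r N' \<longleftrightarrow> N \<subseteq> N'"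
proof
  have Pow: "N' \<subseteq> Pow {..<length (kept_list n r)}" using assms(2) core_subset_Pow by (rule subset_trans)
  assume sub: "pull_back n r N \<subseteq> pull_back n r N'"
  show "N \<subseteq> N'"
  proof
    fix e assume "e \<in> N"
    then have "e \<in> Pow {..<length (kept_list n r)}" using assms(1) core_subset_Pow by (meson subsetD)
    moreover have "origin n r ` e \<in> (`) (origin n r) ` N'"
      using sub \<open>e \<in> N\<close> unfolding pull_back_image[OF assms(1)] pull_back_image[OF assms(2)] by blast
    ultimately show "e \<in> N'"
      using inj_on_image_mem_iff[OF inj_on_image_Pow[OF inj_on_origin] _ Pow] by blast
  qed
next
  assume "N \<subseteq> N'"
  then show "pull_back n r N \<subseteq> pull_back n r N'" unfolding pull_back_def by blast
qed

text \<open>A cut edge joins different classes by \<open>kernel_same_side\<close>, and the only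
  kernel edges that do so are original edges between first copies.\<close>

lemma kernel_cut_untied:
  assumes B: "matching (cut (kernel_edges n r) B)" and ij: "{i, j} \<in> cut (kernel_edges n r) B"
  shows "i < length (kept_list n r)" "j < length (kept_list n r)"
    "\<not> tied n r (origin n r i) (origin n r j)" "{origin n r i, origin n r j} \<in> E"
proof -
  have "i < 3 * length (kept_list n r)" "j < 3 * length (kept_list n r)" "kernel_adj n r i j"
    "(i \<in> B) \<noteq> (j \<in> B)"
    using ij unfolding mem_cut_iff mem_kernel_edges by blast+
  moreover from this show "\<not> tied n r (origin n r i) (origin n r j)" using kernel_same_side[OF B] by blast
  ultimately show "i < length (kept_list n r)" "j < length (kept_list n r)" "{origin n r i, origin n r j} \<in> E"
    unfolding kernel_adj_def r_def by blast+
qed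

lemma kernel_cut_core:
  assumes "matching (cut (kernel_edges n r) B)" shows "cut (kernel_edges n r) B \<subseteq> core"
proof
  fix e assume e: "e \<in> cut (kernel_edges n r) B"
  then obtain i j where "e = {i, j}" by (rule cutE)
  then show "e \<in> core" using kernel_cut_untied[OF assms] e by blast
qed

section \<open>Correspondence of the matching cuts\<close>

lemma cut_nonempty:
  assumes "A \<subseteq> {..<n}" "A \<noteq> {}" "A \<noteq> {..<n}"
  obtains u v where "{u, v} \<in> E" "u \<in> A" "v \<notin> A"
  using closed_eq_all[OF _ assms(1)] assms(2,3) by blast

text \<open>Each copy is put on the side of its origin. A matching cut never separates tied
  vertices, so both ends of a cut edge have an untied neighbour; not being dropped, they are kept,
  and no cut edge is lost.\<close>

lemma cut_to_kernel:
  assumes "matching_cut graph M" "\<And>p. dropped p \<Longrightarrow> p \<notin> \<Union>M"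
  shows "\<exists>N\<subseteq>core. matching_cut kernel N \<and> M = pull_back n r N"
proof -
  let ?m = "length (kept_list n r)"
  obtain A where M: "matching M" "M = cut E A" and A: "A \<subseteq> {..<n}" "A \<noteq> {}" "A \<noteq> {..<n}"
    using assms(1) unfolding matching_cut_iff[OF simple] fst_conv snd_conv by blast
  define B where "B = {i. i < 3 * ?m \<and> origin n r i \<in> A}"
  define N where "N = cut (kernel_edges n r) B"
  have ends: "\<exists>i j. i < ?m \<and> j < ?m \<and> x = origin n r i \<and> y = origin n r j"
    if xy: "{x, y} \<in> E" "x \<in> A" "y \<notin> A" for x y
  proof -
    have "{x, y} \<in> M" using xy unfolding M(2) mem_cut_iff by blast
    then have "\<not> dropped x" "\<not> dropped y" using assms(2) by blast+
    moreover have "\<not> tied n r x y" using tied_same_side[of A x y] M xy by blast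
    moreover have "{y, x} \<in> E" "\<not> tied n r y x" using xy(1) \<open>\<not> tied n r x y\<close> tied_sym
      by (simp_all add: insert_commute) blast
    ultimately have "kept n r x" "kept n r y" using untied_kept xy(1) by blast+
    moreover have "x < n" "y < n" using edgeD[OF xy(1)] by simp_all
    ultimately show ?thesis using origin_onto by metis
  qed
  have untied: "\<not> tied n r u v" if "u \<in> A" "v \<notin> A" for u v
    using tied_same_side[of A u v] M that by blast
  have core: "N \<subseteq> core"
  proof
    fix e assume "e \<in> N"
    then obtain i j where e: "e = {i, j}" "i \<in> B" "j \<notin> B" "{i, j} \<in> kernel_edges n r"
      unfolding N_def by (rule cutE)
    have "i < 3 * ?m" "j < 3 * ?m" "kernel_adj n r i j" using e(4) unfolding mem_kernel_edges by blast+
    moreover have "\<not> tied n r (origin n r i) (origin n r j)"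
      using e(2,3) \<open>j < 3 * ?m\<close> unfolding B_def by (intro untied) blast+
    ultimately show "e \<in> core" unfolding e(1) kernel_adj_def by blast
  qed
  have M_N: "M = pull_back n r N"
  proof
    show "M \<subseteq> pull_back n r N"
    proof
      fix e assume "e \<in> M"
      then obtain x y where xy: "e = {x, y}" "x \<in> A" "y \<notin> A" "{x, y} \<in> E" unfolding M(2) by (rule cutE)
      then obtain i j where ij: "i < ?m" "j < ?m" "x = origin n r i" "y = origin n r j" using ends by blast
      have "x \<noteq> y" using edgeD[OF xy(4)] by simp
      then have "kernel_adj n r i j" using ij xy(4) unfolding kernel_adj_def r_def by auto
      moreover have "i \<in> B" "j \<notin> B" using ij xy(2,3) unfolding B_def by auto
      ultimately have "{i, j} \<in> N" unfolding N_def mem_cut_iff mem_kernel_edges using ij(1,2) by simp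
      then show "e \<in> pull_back n r N" unfolding pull_back_def xy(1) ij(3,4) using ij(1,2) by blast
    qed
    show "pull_back n r N \<subseteq> M"
    proof
      fix e assume "e \<in> pull_back n r N"
      then obtain i j where e: "e = {origin n r i, origin n r j}" "i < ?m" "j < ?m" "{i, j} \<in> N"
        unfolding pull_back_def by blast
      have adj: "kernel_adj n r i j" and B: "(i \<in> B) \<noteq> (j \<in> B)"
        using e(4) unfolding N_def mem_cut_iff mem_kernel_edges by blast+
      have A: "(origin n r i \<in> A) \<noteq> (origin n r j \<in> A)" using B e(2,3) unfolding B_def by simp
      then have "\<not> tied n r (origin n r i) (origin n r j)" using untied tied_sym by blast
      then have "{origin n r i, origin n r j} \<in> E" using adj unfolding kernel_adj_def r_def by blast
      then show "e \<in> M" unfolding M(2) e(1) mem_cut_iff using A by blast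
    qed
  qed
  have "matching N" using M(1) unfolding M_N matching_pull_back[OF core] .
  \<comment> \<open>Connectedness gives an edge across \<open>A\<close>; copies of its ends show
    that neither side of \<open>B\<close> is empty.\<close>
  moreover obtain u v where "{u, v} \<in> E" "u \<in> A" "v \<notin> A" using A by (rule cut_nonempty)
  then obtain i j where "i < ?m" "j < ?m" "origin n r i \<in> A" "origin n r j \<notin> A" using ends by blast
  then have "i \<in> B" "j \<in> {..<3 * ?m}" "j \<notin> B" unfolding B_def by simp_all
  then have "B \<noteq> {}" "B \<noteq> {..<3 * ?m}" by blast+
  moreover have "B \<subseteq> {..<3 * ?m}" unfolding B_def by blast
  ultimately have "matching_cut kernel N"
    unfolding matching_cut_iff[OF simple_kernel] fst_conv snd_conv N_def by blast
  then show ?thesis using M_N core by blast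
qed

text \<open>The side \<open>B\<close> has to be extended to vertices that have no copy. Every vertex
  joins the side of its class, except that a dropped pendant vertex joins the class of its
  neighbour; no new cut edge arises in this way.\<close>

lemma cut_from_kernel:
  assumes "matching_cut kernel N"
  shows "N \<subseteq> core" "matching_cut graph (pull_back n r N)"
proof -
  let ?m = "length (kept_list n r)"
  obtain B where N: "matching N" "N = cut (kernel_edges n r) B"
    and B: "B \<subseteq> {..<3 * ?m}" "B \<noteq> {}" "B \<noteq> {..<3 * ?m}"
    using assms unfolding matching_cut_iff[OF simple_kernel] fst_conv snd_conv by blast
  have mB: "matching (cut (kernel_edges n r) B)" using N by simp
  show core: "N \<subseteq> core" unfolding N(2) by (rule kernel_cut_core[OF mB])
  \<comment> \<open>The choice is determined, since a pendant vertex has exactly one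
    neighbour.\<close>
  define anchor where "anchor v = (if dropped v then SOME w. {v, w} \<in> E else v)" for v
  define A where "A = {v. v < n \<and> (\<exists>i<3 * ?m. i \<in> B \<and> tied n r (anchor v) (origin n r i))}"
  \<comment> \<open>The side of \<open>v\<close> does not depend on the representative: kernel
    vertices with tied origins lie on the same side of \<open>B\<close>.\<close>
  have A_iff: "v \<in> A \<longleftrightarrow> j \<in> B" if "v < n" "j < 3 * ?m" "tied n r (anchor v) (origin n r j)" for v j
  proof
    assume "v \<in> A"
    then obtain i where i: "i < 3 * ?m" "i \<in> B" "tied n r (anchor v) (origin n r i)" unfolding A_def by blast
    have "tied n r (origin n r i) (origin n r j)" using tied_trans[OF tied_sym[OF i(3)] that(3)] .
    then show "j \<in> B" using kernel_same_side[OF mB i(1) that(2)] i(2) by blast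
  next
    assume "j \<in> B"
    then show "v \<in> A" unfolding A_def using that by blast
  qed
  have anchor_dropped: "anchor x = y" if "dropped x" "{x, y} \<in> E" for x y
  proof -
    have "pendant n r x" using that(1) by blast
    then obtain v where v: "\<forall>w. {x, w} \<in> E \<longleftrightarrow> w = v" by (rule pendantE) blast
    then have "(SOME w. {x, w} \<in> E) = v" by simp
    moreover have "y = v" using v that(2) by blast
    ultimately show ?thesis using that(1) unfolding anchor_def by simp
  qed
  have anchor_id: "anchor v = v" if "\<not> dropped v" for v unfolding anchor_def by (rule if_not_P[OF that])
  \<comment> \<open>If some edge leaves the class of \<open>v\<close>, its end in the class is kept:
    it is not dropped, as a dropped vertex is alone in its class. Otherwise the class is closed
    under adjacency, hence the whole graph, and vertex 0 represents it.\<close>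
  have represented: "\<exists>i<3 * ?m. tied n r v (origin n r i)" if "v < n" "\<not> dropped v" for v
  proof -
    have kept: ?thesis if u: "tied n r v u" "u < n" "kept n r u" for u
    proof -
      obtain i where i: "i < ?m" "origin n r i = u" using u(2,3) by (rule origin_onto)
      then show ?thesis using u(1) by (intro exI[of _ i]) simp
    qed
    show ?thesis
    proof (cases "\<exists>u w. tied n r v u \<and> {u, w} \<in> E \<and> \<not> tied n r u w")
      case True
      then obtain u w where u: "tied n r v u" "{u, w} \<in> E" "\<not> tied n r u w" by blast
      have "\<not> dropped u"
      proof
        assume "dropped u"
        then have "v = u" using pendant_tied tied_sym[OF u(1)] by blast
        then show False using \<open>dropped u\<close> that(2) by blast
      qed
      then have "kept n r u" using untied_kept[OF u(2,3)] by blast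
      moreover have "u < n" using edgeD[OF u(2)] by simp
      ultimately show ?thesis using kept u(1) by blast
    next
      case False
      have "{u. u < n \<and> tied n r v u} = {..<n}"
      proof (rule closed_eq_all[of v])
        fix x y assume x: "x \<in> {u. u < n \<and> tied n r v u}" and xy: "{x, y} \<in> E"
        then have "tied n r x y" using False by blast
        then have "tied n r v y" using x tied_trans by blast
        then show "y \<in> {u. u < n \<and> tied n r v u}" using edgeD[OF xy] by blast
      qed (use that(1) in auto)
      then have "tied n r v 0" using n_pos by blast
      then show ?thesis using kept n_pos zero_kept unfolding set_kept_list by blast
    qed
  qed
  have origin_A: "origin n r i \<in> A \<longleftrightarrow> i \<in> B" if "i < 3 * ?m" for i
  proof -
    have "origin n r i < n" "kept n r (origin n r i)" using origin_kept[OF that] unfolding set_kept_list by blast+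
    then show ?thesis using anchor_id kept_not_dropped by (intro A_iff that) simp_all
  qed
  have eq: "cut E A = pull_back n r N"
  proof
    show "cut E A \<subseteq> pull_back n r N"
    proof
      fix e assume "e \<in> cut E A"
      then obtain x y where xy: "e = {x, y}" "x \<in> A" "y \<notin> A" "{x, y} \<in> E" by (rule cutE)
      have yx: "{y, x} \<in> E" using xy(4) by (simp add: insert_commute)
      have lt: "x < n" "y < n" using edgeD[OF xy(4)] by simp_all
      have same: "u \<in> A \<longleftrightarrow> v \<in> A" if uv: "u < n" "v < n" "\<not> dropped v" "tied n r (anchor u) v" for u v
      proof -
        obtain i where i: "i < 3 * ?m" "tied n r v (origin n r i)" using represented uv(2,3) by blast
        have "u \<in> A \<longleftrightarrow> i \<in> B" by (rule A_iff[OF uv(1) i(1) tied_trans[OF uv(4) i(2)]])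
        moreover have "v \<in> A \<longleftrightarrow> i \<in> B"
          using i(2) anchor_id[OF uv(3)] by (intro A_iff uv(2) i(1)) simp
        ultimately show ?thesis by simp
      qed
      \<comment> \<open>The neighbour of a dropped vertex is its anchor and is not pendant, so the
        two lie on the same side.\<close>
      have "\<not> dropped u" if "u < n" "v < n" "{u, v} \<in> E" "(u \<in> A) \<noteq> (v \<in> A)" for u v
      proof
        assume u: "dropped u"
        then have "\<not> dropped v" using pendants_not_adjacent that(3) by blast
        then show False using same[OF that(1,2)] anchor_dropped[OF u that(3)] that(4) by simp
      qed
      then have nd: "\<not> dropped x" "\<not> dropped y" using lt xy yx by blast+
      then have "\<not> tied n r x y" using same[OF lt nd(2)] xy(2,3) unfolding anchor_id[OF nd(1)] by blast
      then have "kept n r x" "kept n r y" using untied_kept xy(4) yx nd tied_sym by blast+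
      obtain i where i: "i < ?m" "origin n r i = x" using lt(1) \<open>kept n r x\<close> by (rule origin_onto)
      obtain j where j: "j < ?m" "origin n r j = y" using lt(2) \<open>kept n r y\<close> by (rule origin_onto)
      have "i \<in> B" "j \<notin> B" using origin_A[of i] origin_A[of j] i j xy(2,3) by simp_all
      moreover have "kernel_adj n r i j"
        using i j xy(2-4) unfolding kernel_adj_def r_def by auto
      ultimately have "{i, j} \<in> N" unfolding N(2) mem_cut_iff mem_kernel_edges using i(1) j(1) by simp
      then show "e \<in> pull_back n r N" unfolding pull_back_def xy(1) using i j by blast
    qed
    show "pull_back n r N \<subseteq> cut E A"
    proof
      fix e assume "e \<in> pull_back n r N"
      then obtain i j where e: "e = {origin n r i, origin n r j}" "i < ?m" "j < ?m" "{i, j} \<in> N"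
        unfolding pull_back_def by blast
      have "{origin n r i, origin n r j} \<in> E" using kernel_cut_untied(4)[OF mB] e(4) N(2) by blast
      moreover have "(i \<in> B) \<noteq> (j \<in> B)" using e(4) unfolding N(2) mem_cut_iff by blast
      ultimately show "e \<in> cut E A" unfolding e(1) mem_cut_iff using origin_A[of i] origin_A[of j] e(2,3) by simp
    qed
  qed
  have "matching (cut E A)" unfolding eq matching_pull_back[OF core] by (rule N(1))
  moreover have "A \<subseteq> {..<n}" unfolding A_def by blast
  moreover obtain i j where ij: "i \<in> B" "i < 3 * ?m" "j \<notin> B" "j < 3 * ?m" using B by blast
  then have "origin n r i \<in> A" "origin n r j \<notin> A" using origin_A by blast+
  moreover have "origin n r j < n" using origin_kept[OF ij(4)] unfolding set_kept_list by blast
  ultimately have "matching_cut graph (cut E A)"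
    unfolding matching_cut_iff[OF simple] fst_conv snd_conv by blast
  then show "matching_cut graph (pull_back n r N)" unfolding eq .
qed

lemma pull_back_not_dropped:
  assumes "dropped p" shows "p \<notin> \<Union>(pull_back n r N)"
proof
  assume "p \<in> \<Union>(pull_back n r N)"
  then obtain i where "i < length (kept_list n r)" "p = origin n r i" unfolding pull_back_def by blast
  then have "kept n r p" using origin_kept[of i] unfolding set_kept_list by simp
  then show False using assms kept_not_dropped by blast
qed

section \<open>Minimal cuts at pendant vertices\<close>

lemma star_eq: "star r p = {e \<in> E. p \<in> e}"
proof
  show "star r p \<subseteq> {e \<in> E. p \<in> e}" unfolding star_def r_def by blast
  show "{e \<in> E. p \<in> e} \<subseteq> star r p"
  proof
    fix e assume e: "e \<in> {e \<in> E. p \<in> e}"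
    then obtain u v where "e = {u, v}" using edge unfolding card_2_iff by blast
    then show "e \<in> star r p" using e unfolding star_def r_def by blast
  qed
qed

lemma star_pendant:
  assumes "pendant n r p"
  obtains v where "star r p = {{p, v}}" "{p, v} \<in> E" "v < n" "v \<noteq> p" "\<not> pendant n r v"
proof -
  obtain v where v: "v < n" "v \<noteq> p" "\<forall>w. {p, w} \<in> E \<longleftrightarrow> w = v" using assms by (rule pendantE) blast
  have pv: "{p, v} \<in> E" using v(3) by blast
  have "e = {p, v}" if e: "e \<in> E" "p \<in> e" for e
  proof -
    obtain x y where xy: "e = {x, y}" using edge e(1) unfolding card_2_iff by blast
    then obtain w where "e = {p, w}"
      using e(2) that[of y] that[of x] by (cases "p = x") (simp_all add: insert_commute)
    then have "{p, w} \<in> E" using e(1) by simp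
    then have "w = v" using v(3) by blast
    then show ?thesis using \<open>e = {p, w}\<close> by simp
  qed
  then have "star r p = {{p, v}}" unfolding star_eq using pv by blast
  then show ?thesis using that pv v(1,2) pendants_not_adjacent[OF assms] by blast
qed

lemma empty_not_matching_cut: "\<not> matching_cut graph {}"
proof
  assume "matching_cut graph {}"
  then obtain A where A: "A \<subseteq> {..<n}" "A \<noteq> {}" "A \<noteq> {..<n}" "{} = cut E A"
    unfolding matching_cut_iff[OF simple] fst_conv snd_conv by blast
  obtain u v where "{u, v} \<in> E" "u \<in> A" "v \<notin> A" using A(1-3) by (rule cut_nonempty)
  then have "{u, v} \<in> cut E A" unfolding mem_cut_iff by blast
  then show False using A(4) by blast
qed

text \<open>The edge separates \<open>p\<close> from everything else. Its only proper subset is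
  empty, and a connected graph has no empty matching cut.\<close>

lemma minimal_star:
  assumes "pendant n r p" shows "minimal_matching_cut graph (star r p)"
proof -
  obtain v where v: "star r p = {{p, v}}" "{p, v} \<in> E" "v < n" "v \<noteq> p" using assms by (rule star_pendant)
  have "p < n" using edgeD[OF v(2)] by simp
  have "cut E {p} = star r p"
  proof
    show "cut E {p} \<subseteq> star r p" unfolding cut_def star_eq by blast
    have "{p, v} \<in> cut E {p}" unfolding mem_cut_iff using v(2,4) by simp
    then show "star r p \<subseteq> cut E {p}" unfolding v(1) by simp
  qed
  moreover have "matching (star r p)" unfolding v(1) matching_def by simp
  moreover have "{p} \<subseteq> {..<n}" "{p} \<noteq> {}" "{p} \<noteq> {..<n}" using \<open>p < n\<close> v(3,4) by (auto simp: set_eq_iff)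
  ultimately have "matching_cut graph (star r p)"
    unfolding matching_cut_iff[OF simple] fst_conv snd_conv by blast
  moreover have "M' = {}" if "M' \<subset> star r p" for M' using that unfolding v(1) by blast
  ultimately show ?thesis unfolding minimal_matching_cut_def using empty_not_matching_cut by blast
qed

text \<open>A cut that touches \<open>p\<close> contains the only edge at \<open>p\<close>, which is
  already a matching cut by itself.\<close>

lemma minimal_with_pendant:
  assumes "minimal_matching_cut graph M" "pendant n r p" "p \<in> \<Union>M"
  shows "M = star r p"
proof -
  obtain v where v: "star r p = {{p, v}}" using assms(2) by (rule star_pendant)
  have "M \<subseteq> E"
    using assms(1) unfolding minimal_matching_cut_def matching_cut_iff[OF simple] cut_def fst_conv snd_conv by blast
  then obtain e where "e \<in> M" "e \<in> star r p" using assms(3) unfolding star_eq by blast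
  then have "star r p \<subseteq> M" unfolding v by blast
  moreover have "matching_cut graph (star r p)"
    using minimal_star[OF assms(2)] unfolding minimal_matching_cut_def by blast
  ultimately show ?thesis using assms(1) unfolding minimal_matching_cut_def by blast
qed

text \<open>Two pendant vertices with the same star would be the ends of one edge.\<close>

lemma inj_on_star: "inj_on (star r) {p. pendant n r p}"
proof (rule inj_onI, rule ccontr)
  fix p q assume pq: "p \<in> {p. pendant n r p}" "q \<in> {p. pendant n r p}" "star r p = star r q" "p \<noteq> q"
  have pend: "pendant n r p" "pendant n r q" using pq(1,2) by simp_all
  obtain v where v: "star r p = {{p, v}}" "{p, v} \<in> E" using pend(1) by (rule star_pendant)
  obtain w where w: "star r q = {{q, w}}" using pend(2) by (rule star_pendant)
  have "{p, v} = {q, w}" using pq(3) unfolding v(1) w by (simp only: singleton_inject)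
  then have "q = v" using pq(4) unfolding doubleton_eq_iff by blast
  then show False using pendants_not_adjacent[OF pend] v(2) by blast
qed

section \<open>Transfer of minimality and the partition of the solutions\<close>

lemma pull_back_inj: "N \<subseteq> core \<Longrightarrow> N' \<subseteq> core \<Longrightarrow> pull_back n r N = pull_back n r N' \<Longrightarrow> N = N'"
  using pull_back_subset_iff[of N N'] pull_back_subset_iff[of N' N] by simp

text \<open>A smaller cut on either side yields a smaller one on the other. From graph to kernel
  this works because a subset of a pulled-back cut still avoids the dropped vertices.\<close>

lemma minimal_kernel_iff:
  assumes "N \<subseteq> core"
  shows "minimal_matching_cut kernel N \<longleftrightarrow> minimal_matching_cut graph (pull_back n r N)"
proof
  assume N: "minimal_matching_cut kernel N"
  then have "matching_cut graph (pull_back n r N)"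
    unfolding minimal_matching_cut_def by (intro cut_from_kernel(2)) (rule conjunct1)
  moreover have False if M: "matching_cut graph M" "M \<subset> pull_back n r N" for M
  proof -
    have not_dropped: "p \<notin> \<Union>M" if "dropped p" for p using pull_back_not_dropped[OF that, of N] M(2) by blast
    obtain N' where N': "N' \<subseteq> core" "matching_cut kernel N'" "M = pull_back n r N'"
      using cut_to_kernel[OF M(1) not_dropped] by blast
    then have "N' \<subset> N"
      using M(2) pull_back_subset_iff[OF N'(1) assms] pull_back_subset_iff[OF assms N'(1)] by blast
    then show False using N N'(2) unfolding minimal_matching_cut_def by blast
  qed
  ultimately show "minimal_matching_cut graph (pull_back n r N)" unfolding minimal_matching_cut_def by blast
next
  assume M: "minimal_matching_cut graph (pull_back n r N)"
  then have cut: "matching_cut graph (pull_back n r N)" unfolding minimal_matching_cut_def by (rule conjunct1)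
  obtain N' where "N' \<subseteq> core" "matching_cut kernel N'" "pull_back n r N = pull_back n r N'"
    using cut_to_kernel[OF cut pull_back_not_dropped] by blast
  then have "matching_cut kernel N" using pull_back_inj[OF assms] by simp
  moreover have False if N': "matching_cut kernel N'" "N' \<subset> N" for N'
  proof -
    have core: "N' \<subseteq> core" using N'(2) assms by blast
    have "pull_back n r N' \<subset> pull_back n r N"
      using N'(2) pull_back_subset_iff[OF core assms] pull_back_subset_iff[OF assms core] by blast
    then show False using M cut_from_kernel(2)[OF N'(1)] unfolding minimal_matching_cut_def by blast
  qed
  ultimately show "minimal_matching_cut kernel N" unfolding minimal_matching_cut_def by blast
qed

lemma minimal_kernel_core: "minimal_matching_cut kernel N \<Longrightarrow> N \<subseteq> core"
  unfolding minimal_matching_cut_def using cut_from_kernel(1) by blast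

lemma minimal_to_kernel:
  assumes "minimal_matching_cut graph M" "\<And>p. dropped p \<Longrightarrow> p \<notin> \<Union>M"
  obtains N where "minimal_matching_cut kernel N" "M = pull_back n r N"
proof -
  have "matching_cut graph M" using assms(1) unfolding minimal_matching_cut_def by (rule conjunct1)
  then obtain N where N: "N \<subseteq> core" "M = pull_back n r N" using cut_to_kernel[OF _ assms(2)] by blast
  have "minimal_matching_cut kernel N" using assms(1) unfolding N(2) minimal_kernel_iff[OF N(1)] .
  then show ?thesis using N(2) by (rule that)
qed

lemma set_lift_cuts:
  "set (lift_cuts n r N) =
    (if \<exists>p. first_pendant n r p \<and> p \<in> \<Union>(pull_back n r N)
     then star r ` {p. pendant n r p} else {pull_back n r N})"
proof -
  let ?m = "length (kept_list n r)"
  have "(\<exists>i<?m. \<exists>j<?m. {i, j} \<in> N \<and> first_pendant n r (origin n r i)) \<longleftrightarrow>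
      (\<exists>p. first_pendant n r p \<and> p \<in> \<Union>(pull_back n r N))" (is "?l \<longleftrightarrow> ?r")
  proof
    assume ?l
    then obtain i j where "i < ?m" "j < ?m" "{i, j} \<in> N" "first_pendant n r (origin n r i)" by blast
    then show ?r unfolding pull_back_def by blast
  next
    assume ?r
    then obtain p i j where "first_pendant n r p" "i < ?m" "j < ?m" "{i, j} \<in> N" "p \<in> {origin n r i, origin n r j}"
      unfolding pull_back_def by blast
    moreover from this have "{j, i} \<in> N" by (simp add: insert_commute)
    ultimately show ?l by blast
  qed
  moreover have "set (filter (pendant n r) [0..<n]) = {p. pendant n r p}"
    unfolding pendant_def by auto
  ultimately show ?thesis unfolding lift_cuts_def if_distrib[of set] by (simp only: set_map list.set)
qed

lemma distinct_lift_cuts: "distinct (lift_cuts n r N)"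
proof -
  have "set (filter (pendant n r) [0..<n]) \<subseteq> {p. pendant n r p}" by auto
  then have "distinct (map (star r) (filter (pendant n r) [0..<n]))"
    unfolding distinct_map using inj_on_subset[OF inj_on_star] by simp
  then show ?thesis unfolding lift_cuts_def by simp
qed

lemma lift_cuts_nonempty: "set (lift_cuts n r N) \<noteq> {}"
  unfolding set_lift_cuts first_pendant_def by auto

text \<open>The two kinds of families do not meet: a pulled-back cut that is the star of a pendant
  vertex touches no dropped vertex, so it is the star of the first one and falls under the special
  case. In that case the pulled-back cut is this very star, so only one \<open>N\<close> is special;
  ordinary \<open>N\<close> are told apart by injectivity.\<close>

lemma disjoint_lift_cuts: "disjoint_family_on (\<lambda>N. set (lift_cuts n r N)) {N. minimal_matching_cut kernel N}"
  unfolding disjoint_family_on_def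
proof (intro ballI impI, rule ccontr)
  fix N N' assume N: "N \<in> {N. minimal_matching_cut kernel N}" "N' \<in> {N. minimal_matching_cut kernel N}"
    and "N \<noteq> N'" and "set (lift_cuts n r N) \<inter> set (lift_cuts n r N') \<noteq> {}"
  then obtain M where M: "M \<in> set (lift_cuts n r N)" "M \<in> set (lift_cuts n r N')" by blast
  have core: "N \<subseteq> core" "N' \<subseteq> core" using N minimal_kernel_core by blast+
  have min: "minimal_matching_cut graph (pull_back n r N)" "minimal_matching_cut graph (pull_back n r N')"
    using N minimal_kernel_iff core by blast+
  let ?special = "\<lambda>N. \<exists>p. first_pendant n r p \<and> p \<in> \<Union>(pull_back n r N)"
  have star: "?special N''" if p: "star r p = pull_back n r N''" "pendant n r p" for p N''
  proof -
    obtain v where "star r p = {{p, v}}" using p(2) by (rule star_pendant)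
    then have "p \<in> \<Union>(pull_back n r N'')" unfolding p(1)[symmetric] by simp
    then show ?thesis using pull_back_not_dropped p(2) by blast
  qed
  have pull: "pull_back n r N = star r p"
    if "first_pendant n r p" "p \<in> \<Union>(pull_back n r N)" "minimal_matching_cut graph (pull_back n r N)" for p N
    using minimal_with_pendant[OF that(3) _ that(2)] that(1) unfolding first_pendant_def by blast
  have "pull_back n r N = pull_back n r N'"
  proof (cases "?special N")
    case True
    then obtain p where p: "first_pendant n r p" "p \<in> \<Union>(pull_back n r N)" by blast
    from True obtain q where q: "pendant n r q" "M = star r q" using M(1) unfolding set_lift_cuts by auto
    have "?special N'"
    proof (rule ccontr)
      assume plain: "\<not> ?special N'"
      then have "M = pull_back n r N'" using M(2) unfolding set_lift_cuts if_not_P[OF plain] by blast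
      then show False using star[of q N'] q plain by blast
    qed
    then obtain p' where p': "first_pendant n r p'" "p' \<in> \<Union>(pull_back n r N')" by blast
    have "p' = p" using first_pendant_unique p(1) p'(1) by blast
    then show ?thesis using pull[OF p min(1)] pull[OF p' min(2)] by simp
  next
    case False
    then have M_N: "M = pull_back n r N" using M(1) unfolding set_lift_cuts if_not_P[OF False] by blast
    have plain: "\<not> ?special N'"
    proof
      assume "?special N'"
      then obtain q where "pendant n r q" "M = star r q" using M(2) unfolding set_lift_cuts by auto
      then show False using star[of q N] M_N False by blast
    qed
    then have "M = pull_back n r N'" using M(2) unfolding set_lift_cuts if_not_P[OF plain] by blast
    then show ?thesis using M_N by simp
  qed
  then show False using pull_back_inj[OF core] \<open>N \<noteq> N'\<close> by blast
qed

text \<open>A minimal cut that touches a pendant vertex is its star and is listed under the star of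
  the first pendant vertex; any other one avoids the dropped vertices and comes directly from the
  kernel.\<close>

lemma Union_lift_cuts:
  "(\<Union>N\<in>{N. minimal_matching_cut kernel N}. set (lift_cuts n r N)) = {M. minimal_matching_cut graph M}"
proof (intro subset_antisym subsetI)
  fix M assume "M \<in> (\<Union>N\<in>{N. minimal_matching_cut kernel N}. set (lift_cuts n r N))"
  then obtain N where N: "minimal_matching_cut kernel N" "M \<in> set (lift_cuts n r N)" by blast
  show "M \<in> {M. minimal_matching_cut graph M}"
  proof (cases "\<exists>p. first_pendant n r p \<and> p \<in> \<Union>(pull_back n r N)")
    case True
    then have "M \<in> star r ` {p. pendant n r p}" using N(2) unfolding set_lift_cuts by simp
    then show ?thesis using minimal_star by blast
  next
    case False
    then have "M = pull_back n r N" using N(2) unfolding set_lift_cuts if_not_P[OF False] by blast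
    then show ?thesis using minimal_kernel_iff[OF minimal_kernel_core[OF N(1)]] N(1) by blast
  qed
next
  fix M assume "M \<in> {M. minimal_matching_cut graph M}"
  then have M: "minimal_matching_cut graph M" by simp
  show "M \<in> (\<Union>N\<in>{N. minimal_matching_cut kernel N}. set (lift_cuts n r N))"
  proof (cases "\<exists>p. pendant n r p \<and> p \<in> \<Union>M")
    case True
    then obtain p where p: "pendant n r p" "M = star r p" using minimal_with_pendant[OF M] by blast
    obtain q where q: "first_pendant n r q" using first_pendant_exists[OF p(1)] by blast
    then have "pendant n r q" unfolding first_pendant_def by blast
    then obtain v where v: "star r q = {{q, v}}" "\<not> pendant n r v" by (rule star_pendant)
    \<comment> \<open>The neighbour of a pendant vertex is not pendant, so this star has a
      counterpart in the kernel.\<close>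
    have "x \<notin> \<Union>(star r q)" if "dropped x" for x using that q v by auto
    then obtain N where N: "minimal_matching_cut kernel N" "star r q = pull_back n r N"
      using minimal_to_kernel[OF minimal_star[OF \<open>pendant n r q\<close>]] by blast
    have "q \<in> \<Union>(pull_back n r N)" unfolding N(2)[symmetric] v(1) by simp
    then have "M \<in> set (lift_cuts n r N)" unfolding set_lift_cuts using p q by auto
    then show ?thesis using N(1) by blast
  next
    case False
    then obtain N where N: "minimal_matching_cut kernel N" "M = pull_back n r N"
      using minimal_to_kernel[OF M] by blast
    then have "M \<in> set (lift_cuts n r N)"
      unfolding set_lift_cuts using False unfolding first_pendant_def by auto
    then show ?thesis using N(1) by blast
  qed
qed

end

section \<open>The algorithms\<close>

lemma ptime_outputs:
  assumes "ptime f"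
  obtains c and p :: "nat poly" where "\<And>a. \<exists>t\<le>poly p (size a). outputs_in_time c a (f a) t"
proof -
  obtain c T where T: "poly_bounded T" "\<And>a. \<exists>t\<le>T a. exec c (store_of [a]) t (store_of [f a])"
    using assms unfolding ptime_def by blast
  obtain p where p: "\<And>a. T a \<le> poly p (size a)" using T(1) unfolding poly_bounded_def by blast
  have "store_of [a] = (\<lambda>_. Leaf)(0 := a)" for a by (auto simp: fun_eq_iff split: nat.split)
  then have "\<exists>t\<le>poly p (size a). outputs_in_time c a (f a) t" for a
    using T(2)[of a] p[of a] unfolding outputs_in_time_def by (metis fun_upd_same le_trans)
  then show ?thesis by (rule that)
qed

lemma pnat_comp: "pnat u \<Longrightarrow> ptime f \<Longrightarrow> pnat (\<lambda>e. u (f e))"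
  unfolding pnat_def by (rule ptime_comp)

lemma pbool_less: "pnat f \<Longrightarrow> pnat g \<Longrightarrow> pbool (\<lambda>a. f a < g a)"
  using pbool_ex[of g "\<lambda>a i. i = f a"] pbool_eq_nat[OF pnat_nat_of[OF ptime_right[OF ptime_id]]]
    pnat_comp[OF _ ptime_left[OF ptime_id]] by simp

lemma ptime_bool: "pbool P \<Longrightarrow> ptime (\<lambda>a. tree_of_bool (P a))"
  by (simp add: pbool_def)

lemma ptime_nat: "pnat f \<Longrightarrow> ptime (\<lambda>a. tree_of_nat (f a))"
  by (simp add: pnat_def)

definition plist :: "(tree \<Rightarrow> nat list) \<Rightarrow> bool" where
  "plist l \<longleftrightarrow> ptime (\<lambda>a. tree_of_list (map tree_of_nat (l a)))"

lemma pnat_length: "plist l \<Longrightarrow> pnat (\<lambda>a. length (l a))"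
  unfolding plist_def by (drule pnat_nat_of) simp

lemma pnat_nth0: "plist l \<Longrightarrow> pnat i \<Longrightarrow> pnat (\<lambda>a. nth0 (l a) (i a))"
  unfolding plist_def
  by (drule ptime_nth_tree, assumption, drule pnat_nat_of) (simp add: nth_tree_list nth0_def if_distrib cong: if_cong)

lemma plist_filter_append:
  assumes "pnat N" "pbool (\<lambda>e. P (left e) (nat_of (right e)))" "plist l"
  shows "plist (\<lambda>a. filter (P a) [0..<N a] @ l a)"
  using ptime_map_filter[OF assms(1,2), of "\<lambda>_. tree_of_nat" "\<lambda>a. map tree_of_nat (l a)"]
    ptime_nat[OF pnat_nat_of[OF ptime_right[OF ptime_id]]] assms(3)
  by (simp add: plist_def)

lemma plist_filter:
  assumes "pnat N" "pbool (\<lambda>e. P (left e) (nat_of (right e)))"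
  shows "plist (\<lambda>a. filter (P a) [0..<N a])"
proof -
  have "plist (\<lambda>_. [])" unfolding plist_def by (rule ptime_const)
  from plist_filter_append[OF assms this] show ?thesis by simp
qed

section \<open>Polynomial time for the graph predicates\<close>

definition adj_of :: "tree \<Rightarrow> nat \<Rightarrow> nat \<Rightarrow> bool" where
  "adj_of a u v \<longleftrightarrow> nth_tree (nth_tree a u) v \<noteq> Leaf"

lemma nat_of_adjacency_matrix [simp]: "nat_of (adjacency_matrix n E) = n"
  by (simp add: adjacency_matrix_def)

text \<open>The two relations agree on all numbers, as lookups outside the matrix give
  \<open>Leaf\<close>. The equation thus rewrites inside every predicate that takes a relation as
  argument.\<close>

lemma adj_of_adjacency_matrix:
  assumes "\<forall>e\<in>E. e \<subseteq> {..<n}"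
  shows "adj_of (adjacency_matrix n E) = (\<lambda>u v. {u, v} \<in> E)"
proof (intro ext)
  fix u v
  have [simp]: "nth_tree Leaf i = Leaf" for i by (induction i) simp_all
  show "adj_of (adjacency_matrix n E) u v = ({u, v} \<in> E)"
  proof (cases "u < n \<and> v < n")
    case True
    then show ?thesis unfolding adj_of_def adjacency_matrix_def by (simp add: nth_tree_list)
  next
    case False
    then have "{u, v} \<notin> E" using assms by fastforce
    then show ?thesis using False unfolding adj_of_def adjacency_matrix_def by (auto simp: nth_tree_list)
  qed
qed

text \<open>One rule per connective, bounded quantifier and closure operator: polynomial time of the
  predicates below is derived by following the syntax of their definitions.\<close>

lemmas ptime_intros =
  pbool_ex pbool_all pbool_conj pbool_disj pbool_imp pbool_not pbool_eq_nat pbool_less pbool_rtrancl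
  pnat_const pnat_nat_of pnat_mult pnat_length pnat_nth0 plist_filter plist_filter_append
  ptime_bool ptime_nat ptime_left ptime_right ptime_id

lemma pbool_adj_of:
  assumes "ptime A" "pnat u" "pnat v" shows "pbool (\<lambda>e. adj_of (A e) (u e) (v e))"
  unfolding adj_of_def by (intro pbool_not pbool_eq_tree ptime_nth_tree ptime_const assms)

text \<open>The tree and the vertices are functions of an arbitrary environment, so that the rule
  also applies under binders; composing \<open>A\<close>, \<open>u\<close> and \<open>v\<close> with
  projections looks them up in the enlarged environment.\<close>

lemma pbool_strong:
  assumes A: "ptime A" and u: "pnat u" and v: "pnat v"
  shows "pbool (\<lambda>e. strong (nat_of (A e)) (adj_of (A e)) (u e) (v e))"
  unfolding strong_def
  by (intro ptime_intros pbool_adj_of ptime_comp[OF A] pnat_comp[OF u] pnat_comp[OF v])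

lemma pbool_pendant:
  assumes A: "ptime A" and u: "pnat u"
  shows "pbool (\<lambda>e. pendant (nat_of (A e)) (adj_of (A e)) (u e))"
  unfolding pendant_def
  by (intro ptime_intros pbool_adj_of ptime_comp[OF A] pnat_comp[OF u])

lemma pbool_tied:
  assumes A: "ptime A" and u: "pnat u" and v: "pnat v"
  shows "pbool (\<lambda>e. tied (nat_of (A e)) (adj_of (A e)) (u e) (v e))"
  unfolding tied_def
  by (intro ptime_intros pbool_strong ptime_comp[OF A] u v)

lemma pbool_conn:
  assumes A: "ptime A"
  shows "pbool (\<lambda>e. conn (nat_of (A e)) (adj_of (A e)))"
  unfolding conn_def
  by (intro ptime_intros pbool_adj_of ptime_comp[OF A])

lemma pbool_first_pendant:
  assumes A: "ptime A" and u: "pnat u"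
  shows "pbool (\<lambda>e. first_pendant (nat_of (A e)) (adj_of (A e)) (u e))"
  unfolding first_pendant_def
  by (intro ptime_intros pbool_pendant ptime_comp[OF A] u)

lemma pbool_kept:
  assumes A: "ptime A" and u: "pnat u"
  shows "pbool (\<lambda>e. kept (nat_of (A e)) (adj_of (A e)) (u e))"
  unfolding kept_def
  by (intro ptime_intros pbool_tied pbool_pendant pbool_first_pendant pbool_adj_of
      ptime_comp[OF A] pnat_comp[OF u])

lemma plist_kept_list:
  assumes A: "ptime A"
  shows "plist (\<lambda>e. kept_list (nat_of (A e)) (adj_of (A e)))"
  unfolding kept_list_def
  by (intro ptime_intros pbool_kept ptime_comp[OF A])

lemma pnat_origin:
  assumes A: "ptime A" and u: "pnat u"
  shows "pnat (\<lambda>e. origin (nat_of (A e)) (adj_of (A e)) (u e))"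
  unfolding origin_def unfolding kept_list_def
  by (intro ptime_intros pbool_kept ptime_comp[OF A] u)

lemma pbool_kernel_adj:
  assumes A: "ptime A" and u: "pnat u" and v: "pnat v"
  shows "pbool (\<lambda>e. kernel_adj (nat_of (A e)) (adj_of (A e)) (u e) (v e))"
  unfolding kernel_adj_def
  by (intro ptime_intros pbool_tied pnat_origin plist_kept_list pbool_adj_of assms)

definition matrix :: "nat \<Rightarrow> (nat \<Rightarrow> nat \<Rightarrow> bool) \<Rightarrow> tree" where
  "matrix n P = tree_of_list (map (\<lambda>u. tree_of_list (map (\<lambda>v. tree_of_bool (P u v)) [0..<n])) [0..<n])"

lemma ptime_matrix:
  assumes N: "pnat N" and "pbool (\<lambda>e. P (left (left e)) (nat_of (right (left e))) (nat_of (right e)))"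
  shows "ptime (\<lambda>a. matrix (N a) (P a))"
  unfolding matrix_def by (intro ptime_map ptime_bool assms(2) pnat_comp[OF N] ptime_left ptime_id)

lemma adjacency_matrix_eq_matrix:
  assumes "\<And>u v. u < n \<Longrightarrow> v < n \<Longrightarrow> P u v \<longleftrightarrow> {u, v} \<in> E"
  shows "adjacency_matrix n E = matrix n P"
  unfolding adjacency_matrix_def matrix_def
  by (intro arg_cong[of _ _ tree_of_list] map_cong refl arg_cong[of _ _ tree_of_bool]) (simp add: assms)

section \<open>Kernel and lifting on encodings, and the size of encodings\<close>

definition kernel_tree :: "tree \<Rightarrow> tree" where
  "kernel_tree a =
     (if conn (nat_of a) (adj_of a)
      then matrix (3 * length (kept_list (nat_of a) (adj_of a))) (kernel_adj (nat_of a) (adj_of a))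
      else adjacency_matrix 2 {})"

lemma ptime_kernel_tree: "ptime kernel_tree"
proof -
  have "ptime (\<lambda>a. kernel_tree a)" unfolding kernel_tree_def
    by (intro ptime_If ptime_matrix pbool_conn pbool_kernel_adj plist_kept_list ptime_const ptime_intros)
  then show ?thesis by simp
qed

definition lift_tree :: "tree \<Rightarrow> tree" where
  "lift_tree e = (let a = left e; n = nat_of a; r = adj_of a; s = adj_of (right (right e)) in
     (if \<exists>i<length (kept_list n r). \<exists>j<length (kept_list n r). s i j \<and> first_pendant n r (origin n r i)
      then tree_of_list (map (\<lambda>p. matrix n (\<lambda>u v. r u v \<and> (u = p \<or> v = p))) (filter (pendant n r) [0..<n]))
      else Node (matrix n (\<lambda>u v. \<exists>i<length (kept_list n r). \<exists>j<length (kept_list n r).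
        s i j \<and> origin n r i = u \<and> origin n r j = v)) Leaf))"

lemma ptime_lift_tree: "ptime lift_tree"
proof -
  have "ptime (\<lambda>a. lift_tree a)" unfolding lift_tree_def Let_def
    by (intro ptime_If ptime_filter_map ptime_matrix ptime_Node pbool_first_pendant pbool_pendant pnat_origin
        plist_kept_list pbool_adj_of ptime_const ptime_intros)
  then show ?thesis by simp
qed

text \<open>An entry costs at most a list cell and a bit, hence the 2; each row needs one more
  cell.\<close>

lemma size_adjacency_matrix_le: "size (adjacency_matrix n E) \<le> n * (2 * n + 1)"
proof -
  have row: "size (tree_of_list (map (\<lambda>v. tree_of_bool (P v)) xs)) \<le> 2 * length xs" for P and xs :: "nat list"
    by (induction xs) (auto simp: tree_of_bool_def)
  have "size (tree_of_list (map (\<lambda>u. tree_of_list (map (\<lambda>v. tree_of_bool ({u, v} \<in> E)) [0..<n])) xs))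
      \<le> length xs * (2 * n + 1)" for xs
  proof (induction xs)
    case (Cons u xs)
    then show ?case using row[of "\<lambda>v. {u, v} \<in> E" "[0..<n]"] by simp
  qed simp
  from this[of "[0..<n]"] show ?thesis unfolding adjacency_matrix_def by simp
qed

text \<open>The time allowed for lifting does not mention the size of the given solution; as a set
  of kernel edges, its matrix is no larger than that of the kernel.\<close>

lemma size_adjacency_matrix_mono:
  assumes "E \<subseteq> F" shows "size (adjacency_matrix n E) \<le> size (adjacency_matrix n F)"
proof -
  have mono: "size (tree_of_list (map f xs)) \<le> size (tree_of_list (map g xs))"
    if "\<And>x. size (f x) \<le> size (g x)" for f g and xs :: "nat list"
    using that by (induction xs) (auto intro: add_mono)
  show ?thesis unfolding adjacency_matrix_def
    by (intro mono) (use assms in \<open>auto simp: tree_of_bool_def\<close>)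
qed

definition kernel_graph :: "nat graph \<Rightarrow> nat graph" where
  "kernel_graph G = (let n = card (verts G); r = (\<lambda>u v. {u, v} \<in> edges G) in
     if conn n r then ({..<3 * length (kept_list n r)}, kernel_edges n r) else ({..<2}, {}))"

definition lift_graph :: "nat graph \<Rightarrow> nat set set \<Rightarrow> nat set set list" where
  "lift_graph G = lift_cuts (card (verts G)) (\<lambda>u v. {u, v} \<in> edges G)"

section \<open>Correctness for all instances, connected or not\<close>

locale graph_instance =
  fixes G :: "nat graph" and n :: nat
  assumes simple: "simple_graph G" and verts: "verts G = {..<n}"
begin

abbreviation adj :: "nat \<Rightarrow> nat \<Rightarrow> bool" where
  "adj \<equiv> \<lambda>u v. {u, v} \<in> edges G"

lemma card_verts [simp]: "card (verts G) = n"
  by (simp add: verts)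

lemma n_pos: "0 < n"
  using simple verts unfolding simple_graph_def by auto

lemma edge: "e \<in> edges G \<Longrightarrow> e \<subseteq> {..<n} \<and> card e = 2"
  using simple verts unfolding simple_graph_def by simp

lemma G_eq: "G = ({..<n}, edges G)"
  using verts by (simp add: prod_eq_iff)

lemma connected_graph: "conn n adj \<Longrightarrow> connected_graph n (edges G)"
  by unfold_locales (use n_pos edge in auto)

lemma kernel_conn: "conn n adj \<Longrightarrow> kernel_graph G = ({..<3 * length (kept_list n adj)}, kernel_edges n adj)"
  unfolding kernel_graph_def by (simp add: Let_def)

lemma kernel_disconn: "\<not> conn n adj \<Longrightarrow> kernel_graph G = ({..<2}, {})"
  unfolding kernel_graph_def by (simp add: Let_def)

lemma kernel_inst: "simple_graph (kernel_graph G) \<and> (\<exists>m. verts (kernel_graph G) = {..<m})"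
proof (cases "conn n adj")
  case True
  then show ?thesis
    using connected_graph.simple_kernel[OF connected_graph] by (simp add: kernel_conn)
next
  case False
  have "simple_graph ({..<2 :: nat}, {})" unfolding simple_graph_def by (simp add: lessThan_empty_iff)
  then show ?thesis using False by (auto simp: kernel_disconn)
qed

lemma card_kernel_le: "card (verts (kernel_graph G)) \<le> 6 * modular_width G"
proof (cases "conn n adj")
  case True
  have "length (kept_list n adj) \<le> 2 * modular_width G"
    using connected_graph.length_kept_list_le[OF connected_graph[OF True]] unfolding G_eq[symmetric] .
  then show ?thesis using True by (simp add: kernel_conn)
next
  case False
  then show ?thesis using modular_width_pos[OF simple] by (simp add: kernel_disconn)
qed

lemma adj_of_enc: "adj_of (adjacency_matrix n (edges G)) = adj"
  by (rule adj_of_adjacency_matrix) (use edge in blast)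

lemma kernel_tree_eq:
  "kernel_tree (adjacency_matrix n (edges G)) =
    adjacency_matrix (card (verts (kernel_graph G))) (edges (kernel_graph G))"
proof (cases "conn n adj")
  case True
  have "adjacency_matrix (3 * length (kept_list n adj)) (kernel_edges n adj) =
      matrix (3 * length (kept_list n adj)) (kernel_adj n adj)"
    by (rule adjacency_matrix_eq_matrix)
      (simp add: connected_graph.mem_kernel_edges[OF connected_graph[OF True]])
  then show ?thesis using True unfolding kernel_tree_def by (simp add: adj_of_enc kernel_conn)
next
  case False
  then show ?thesis unfolding kernel_tree_def by (simp add: adj_of_enc kernel_disconn)
qed

lemma lift_tree_eq:
  assumes "\<forall>e\<in>s. e \<subseteq> {..<m}"
  shows "lift_tree (Node (adjacency_matrix n (edges G)) (Node y (adjacency_matrix m s))) =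
    tree_of_list (map (adjacency_matrix n) (lift_graph G s))"
proof -
  have sym: "adj u v \<longleftrightarrow> adj v u" for u v by (simp add: insert_commute)
  have star: "adjacency_matrix n (star adj p) = matrix n (\<lambda>u v. adj u v \<and> (u = p \<or> v = p))" for p
  proof (rule adjacency_matrix_eq_matrix)
    fix u v
    show "adj u v \<and> (u = p \<or> v = p) \<longleftrightarrow> {u, v} \<in> star adj p"
      unfolding star_def mem_Collect_eq doubleton_eq_iff using sym by blast
  qed
  have pull: "adjacency_matrix n (pull_back n adj s) =
      matrix n (\<lambda>u v. \<exists>i<length (kept_list n adj). \<exists>j<length (kept_list n adj).
        {i, j} \<in> s \<and> origin n adj i = u \<and> origin n adj j = v)" (is "_ = matrix n ?P")
  proof (rule adjacency_matrix_eq_matrix)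
    \<comment> \<open>The program tests only one orientation of the pair; exchanging
      \<open>i\<close> and \<open>j\<close> gives the other.\<close>
    have P_sym: "?P v u" if uv: "?P u v" for u v
    proof -
      obtain i j where ij: "i < length (kept_list n adj)" "j < length (kept_list n adj)"
        "{i, j} \<in> s" "origin n adj i = u" "origin n adj j = v" using uv by blast
      have "{j, i} \<in> s" using ij(3) by (simp add: insert_commute)
      then show ?thesis using ij by blast
    qed
    fix u v
    show "?P u v \<longleftrightarrow> {u, v} \<in> pull_back n adj s"
    proof
      assume "?P u v"
      then show "{u, v} \<in> pull_back n adj s" unfolding pull_back_def by blast
    next
      assume "{u, v} \<in> pull_back n adj s"
      then obtain i j where ij: "i < length (kept_list n adj)" "j < length (kept_list n adj)" "{i, j} \<in> s"
        "{u, v} = {origin n adj i, origin n adj j}" unfolding pull_back_def by blast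
      from ij(4) consider "u = origin n adj i" "v = origin n adj j" | "v = origin n adj i" "u = origin n adj j"
        unfolding doubleton_eq_iff by blast
      then show "?P u v"
      proof cases
        case 1
        then show ?thesis using ij(1-3) by blast
      next
        case 2
        then have "?P v u" using ij(1-3) by blast
        then show ?thesis by (rule P_sym)
      qed
    qed
  qed
  show ?thesis
    unfolding lift_tree_def Let_def lift_graph_def lift_cuts_def left.simps right.simps
      nat_of_adjacency_matrix adj_of_enc adj_of_adjacency_matrix[OF assms] card_verts
      if_distrib[of "map (adjacency_matrix n)"] if_distrib[of tree_of_list]
      map_map o_def star list.map pull tree_of_list.simps ..
qed

lemma lift_partition:
  defines "S \<equiv> {s. minimal_matching_cut (kernel_graph G) s}"
  shows "\<forall>s\<in>S. distinct (lift_graph G s) \<and> set (lift_graph G s) \<noteq> {}"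
    and "disjoint_family_on (\<lambda>s. set (lift_graph G s)) S"
    and "(\<Union>s\<in>S. set (lift_graph G s)) = {M. minimal_matching_cut G M}"
proof -
  have "(\<forall>s\<in>S. distinct (lift_graph G s) \<and> set (lift_graph G s) \<noteq> {}) \<and>
    disjoint_family_on (\<lambda>s. set (lift_graph G s)) S \<and>
    (\<Union>s\<in>S. set (lift_graph G s)) = {M. minimal_matching_cut G M}"
  proof (cases "conn n adj")
    case True
    interpret connected_graph n "edges G" adj
      by (fact connected_graph[OF True]) (rule reflexive)
    have S: "S = {N. minimal_matching_cut kernel N}" unfolding S_def kernel_conn[OF True] ..
    have "{M. minimal_matching_cut G M} = {M. minimal_matching_cut graph M}" using G_eq by simp
    then show ?thesis unfolding S lift_graph_def card_verts
      using distinct_lift_cuts lift_cuts_nonempty disjoint_lift_cuts Union_lift_cuts by simp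
  next
    case False
    \<comment> \<open>An empty matching cut is a proper subset of every other one.\<close>
    have min: "{M. minimal_matching_cut H M} = {{}}" if empty: "matching_cut H {}" for H :: "nat graph"
    proof -
      have "M = {}" if "minimal_matching_cut H M" for M
      proof (rule ccontr)
        assume "M \<noteq> {}"
        then have "{} \<subset> M" by blast
        with empty that show False unfolding minimal_matching_cut_def by blast
      qed
      moreover have "minimal_matching_cut H {}" using empty unfolding minimal_matching_cut_def by simp
      ultimately show ?thesis by blast
    qed
    have "simple_graph ({..<2 :: nat}, {})" unfolding simple_graph_def by (simp add: lessThan_empty_iff)
    moreover have "{0} \<subseteq> {..<2 :: nat}" by simp
    moreover have "1 \<in> {..<2 :: nat}" "1 \<notin> {0 :: nat}" by simp_all
    then have "{0 :: nat} \<noteq> {..<2}" by blast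
    moreover have "matching ({} :: nat set set)" by (simp add: matching_def)
    moreover have "cut {} {0 :: nat} = {}" by (simp add: cut_def)
    ultimately have "matching_cut ({..<2 :: nat}, {}) {}"
      unfolding matching_cut_iff[OF \<open>simple_graph ({..<2 :: nat}, {})\<close>] fst_conv snd_conv by blast
    then have S: "S = {{}}" unfolding S_def kernel_disconn[OF False] by (rule min)
    \<comment> \<open>The component of vertex 0: no edge leaves it, and it is not
      everything.\<close>
    define A where "A = {v. v < n \<and> (0, v) \<in> (restricted n adj)\<^sup>*}"
    have "cut (edges G) A = {}"
    proof (rule ccontr)
      assume "cut (edges G) A \<noteq> {}"
      then obtain e where "e \<in> cut (edges G) A" by blast
      then obtain x y where xy: "x \<in> A" "y \<notin> A" "{x, y} \<in> edges G" by (rule cutE)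
      have "y < n" "x < n" using edge[OF xy(3)] by auto
      then have "(x, y) \<in> restricted n adj" using xy(3) by (simp add: restricted_def)
      then have "y \<in> A" using xy(1) \<open>y < n\<close> unfolding A_def by (blast intro: rtrancl_into_rtrancl)
      then show False using xy(2) by blast
    qed
    moreover have "0 \<in> A" using n_pos by (simp add: A_def)
    moreover have "A \<subseteq> {..<n}" unfolding A_def by blast
    moreover have "A \<noteq> {..<n}" using False unfolding conn_def A_def by blast
    ultimately have "matching_cut G {}"
      unfolding matching_cut_iff[OF simple] verts using \<open>matching ({} :: nat set set)\<close> by blast
    then have G: "{M. minimal_matching_cut G M} = {{}}" by (rule min)
    \<comment> \<open>The empty solution fails the membership test in \<open>lift_cuts\<close> and
      is pulled back to the empty cut.\<close>
    have "lift_graph G {} = [{}]" unfolding lift_graph_def lift_cuts_def pull_back_def by simp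
    then show ?thesis unfolding S G by (simp add: disjoint_family_on_def)
  qed
  then show "\<forall>s\<in>S. distinct (lift_graph G s) \<and> set (lift_graph G s) \<noteq> {}"
    "disjoint_family_on (\<lambda>s. set (lift_graph G s)) S"
    "(\<Union>s\<in>S. set (lift_graph G s)) = {M. minimal_matching_cut G M}" by blast+
qed

end

text \<open>A kernel with m vertices has size plus width at most m(2m+1) + m. For m at most 6k this
  is at most 72 k^2 + 12 k, hence at most 84 k^2 since k is positive.\<close>

lemma computable_quadratic: "computable (\<lambda>k. 84 * (k * k))"
proof -
  have "ptime (\<lambda>a. tree_of_nat (84 * (nat_of a * nat_of a)))" by (intro ptime_intros)
  then obtain c and p :: "nat poly" where
    "\<And>a. \<exists>t\<le>poly p (size a). outputs_in_time c a (tree_of_nat (84 * (nat_of a * nat_of a))) t"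
    by (rule ptime_outputs) blast
  then have "\<exists>t. outputs_in_time c (tree_of_nat k) (tree_of_nat (84 * (nat_of (tree_of_nat k) * nat_of (tree_of_nat k)))) t" for k
    by blast
  then show ?thesis unfolding computable_def nat_of_tree_of_nat by blast
qed

theorem theorem24:
  "\<exists>(kern :: nat graph \<Rightarrow> nat graph) (lift :: nat graph \<Rightarrow> nat set set \<Rightarrow> nat set set list).
     fully_polynomial_enumeration_kernel enum_minimal_mc kern lift \<and>
     (\<forall>G\<in>Inst enum_minimal_mc. card (verts (kern G)) \<le> 6 * modular_width G)"
proof (intro exI conjI ballI)
  let ?P = enum_minimal_mc
  have Inst: "\<exists>n. graph_instance G n" if "G \<in> Inst ?P" for G
    using that unfolding enum_minimal_mc_def graph_instance_def by auto
  have param [simp]: "param ?P = modular_width" and Sol [simp]: "Sol ?P = (\<lambda>G. {M. minimal_matching_cut G M})"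
    and enc [simp]: "inst_enc ?P = (\<lambda>G. adjacency_matrix (card (verts G)) (edges G))"
    "sol_enc ?P = (\<lambda>G M. adjacency_matrix (card (verts G)) M)"
    by (simp_all add: enum_minimal_mc_def)
  show "card (verts (kernel_graph G)) \<le> 6 * modular_width G" if "G \<in> Inst ?P" for G
    using Inst[OF that] graph_instance.card_kernel_le by blast
  show "fully_polynomial_enumeration_kernel ?P kernel_graph lift_graph"
    unfolding fully_polynomial_enumeration_kernel_def
  proof (intro conjI)
    show "\<forall>G\<in>Inst ?P. kernel_graph G \<in> Inst ?P"
    proof
      fix G assume "G \<in> Inst ?P"
      then obtain n where "graph_instance G n" using Inst by blast
      then show "kernel_graph G \<in> Inst ?P"
        using graph_instance.kernel_inst unfolding enum_minimal_mc_def by simp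
    qed
    obtain c and p :: "nat poly" where
      p: "\<And>a. \<exists>t\<le>poly p (size a). outputs_in_time c a (kernel_tree a) t"
      using ptime_kernel_tree by (rule ptime_outputs) blast
    have "\<exists>t\<le>poly p (inst_size ?P G + param ?P G).
        outputs_in_time c (inst_enc ?P G) (inst_enc ?P (kernel_graph G)) t" if G: "G \<in> Inst ?P" for G
    proof -
      obtain n where "graph_instance G n" using Inst[OF G] by blast
      then interpret graph_instance G n .
      obtain t where "t \<le> poly p (inst_size ?P G)"
        "outputs_in_time c (inst_enc ?P G) (inst_enc ?P (kernel_graph G)) t"
        using p[of "inst_enc ?P G"] kernel_tree_eq by (auto simp: inst_size_def)
      then show ?thesis using poly_mono_nat[of "inst_size ?P G" "inst_size ?P G + param ?P G" p]
        by (meson le_add1 le_trans)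
    qed
    then show "\<exists>\<A> (p :: nat poly). \<forall>G\<in>Inst ?P. \<exists>t\<le>poly p (inst_size ?P G + param ?P G).
        outputs_in_time \<A> (inst_enc ?P G) (inst_enc ?P (kernel_graph G)) t" by blast
    have "inst_size ?P (kernel_graph G) + param ?P (kernel_graph G) \<le> 84 * (param ?P G * param ?P G)"
      if G: "G \<in> Inst ?P" for G
    proof -
      obtain n where "graph_instance G n" using Inst[OF G] by blast
      then interpret graph_instance G n .
      let ?m = "card (verts (kernel_graph G))" and ?k = "modular_width G"
      have "inst_size ?P (kernel_graph G) + param ?P (kernel_graph G) \<le> ?m * (2 * ?m + 1) + ?m"
        using size_adjacency_matrix_le modular_width_le_card kernel_inst
        unfolding inst_size_def enc param by (intro add_mono) blast+
      also have "\<dots> \<le> 6 * ?k * (2 * (6 * ?k) + 1) + 6 * ?k"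
        using card_kernel_le by (intro add_mono mult_mono) auto
      also have "\<dots> = 72 * (?k * ?k) + 12 * ?k" by (simp add: algebra_simps)
      also have "\<dots> \<le> 84 * (?k * ?k)" using modular_width_pos[OF simple] by simp
      finally show ?thesis by simp
    qed
    then show "\<exists>f. computable f \<and> (\<forall>G\<in>Inst ?P.
        inst_size ?P (kernel_graph G) + param ?P (kernel_graph G) \<le> f (param ?P G))"
      using computable_quadratic by blast
    obtain d and q :: "nat poly" where
      q: "\<And>a. \<exists>t\<le>poly q (size a). outputs_in_time d a (lift_tree a) t"
      using ptime_lift_tree by (rule ptime_outputs) blast
    \<comment> \<open>The input of the lifting program has two extra nodes, and the solution is no
      larger than the kernel, so its size is at most 2 + 2 \<open>?N\<close>.\<close>
    let ?q = "pcompose q [:2, 2:]"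
    have "\<exists>t\<le>poly ?q (inst_size ?P G + inst_size ?P (kernel_graph G) + param ?P G + param ?P (kernel_graph G)).
        outputs_in_time d
          (Node (inst_enc ?P G) (Node (inst_enc ?P (kernel_graph G)) (sol_enc ?P (kernel_graph G) s)))
          (tree_of_list (map (sol_enc ?P G) (lift_graph G s))) t"
      if G: "G \<in> Inst ?P" and s: "s \<in> Sol ?P (kernel_graph G)" for G s
    proof -
      obtain n where "graph_instance G n" using Inst[OF G] by blast
      then interpret graph_instance G n .
      let ?K = "kernel_graph G"
      let ?in = "Node (inst_enc ?P G) (Node (inst_enc ?P ?K) (sol_enc ?P ?K s))"
      let ?N = "inst_size ?P G + inst_size ?P ?K + param ?P G + param ?P ?K"
      obtain m where K: "simple_graph ?K" "verts ?K = {..<m}" using kernel_inst by blast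
      have "s \<subseteq> edges ?K"
        using s unfolding Sol minimal_matching_cut_def matching_cut_iff[OF K(1)] cut_def by blast
      then have "size (sol_enc ?P ?K s) \<le> inst_size ?P ?K"
        unfolding inst_size_def enc by (rule size_adjacency_matrix_mono)
      then have "size ?in \<le> 2 + 2 * ?N" by (simp add: inst_size_def)
      then have "poly q (size ?in) \<le> poly ?q ?N"
        unfolding poly_pcompose by (intro poly_mono_nat) simp
      moreover have "lift_tree ?in = tree_of_list (map (sol_enc ?P G) (lift_graph G s))"
      proof -
        have "\<forall>e\<in>s. e \<subseteq> {..<m}"
          using \<open>s \<subseteq> edges ?K\<close> K(1) unfolding simple_graph_def K(2) by blast
        then show ?thesis using lift_tree_eq[of s m] K(2) by simp
      qed
      ultimately show ?thesis using q[of ?in] by (auto intro: le_trans)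
    qed
    then show "\<exists>\<A>' (q :: nat poly). \<forall>G\<in>Inst ?P. \<forall>s\<in>Sol ?P (kernel_graph G).
        \<exists>t\<le>poly q (inst_size ?P G + inst_size ?P (kernel_graph G) + param ?P G + param ?P (kernel_graph G)).
          outputs_in_time \<A>'
            (Node (inst_enc ?P G) (Node (inst_enc ?P (kernel_graph G)) (sol_enc ?P (kernel_graph G) s)))
            (tree_of_list (map (sol_enc ?P G) (lift_graph G s))) t"
      by blast
    show "\<forall>G\<in>Inst ?P.
        (\<forall>s\<in>Sol ?P (kernel_graph G). distinct (lift_graph G s) \<and> set (lift_graph G s) \<noteq> {}) \<and>
        disjoint_family_on (\<lambda>s. set (lift_graph G s)) (Sol ?P (kernel_graph G)) \<and>
        (\<Union>s\<in>Sol ?P (kernel_graph G). set (lift_graph G s)) = Sol ?P G"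
    proof
      fix G assume "G \<in> Inst ?P"
      then obtain n where "graph_instance G n" using Inst by blast
      then show "(\<forall>s\<in>Sol ?P (kernel_graph G). distinct (lift_graph G s) \<and> set (lift_graph G s) \<noteq> {}) \<and>
        disjoint_family_on (\<lambda>s. set (lift_graph G s)) (Sol ?P (kernel_graph G)) \<and>
        (\<Union>s\<in>Sol ?P (kernel_graph G). set (lift_graph G s)) = Sol ?P G"
        unfolding Sol by (intro conjI graph_instance.lift_partition)
    qed
  qed
qed

end
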